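(* Let $n\ge1$, $s>0$, $\lambda>1$ and $1\le p\le\infty$. Then $$\mathcal{L}^{p}_{s+\ln,\lambda}(\mathbb R^n) = L^p_{2s,1}(\mathbb R^n),$$ and their norms are equivalent. More precisely, there exists a constant $C=C(n,p,s,\lambda)\ge 1$ such that for all $u\in\mathcal S(\mathbb R^n)$, $$C^{-1}\|u\|_{L^{p}_{2s,1}}\le\|u\|_{\mathcal{L}^{p}_{s+\ln,\lambda}}\le C\|u\|_{L^{p}_{2s,1}}.$$
   Context: The Fourier transform is $\mathcal F u(\xi)=\widehat u(\xi)=\int_{\mathbb{R}^n}u(x)e^{-2\pi i x\cdot\xi}\,dx$, extended to $\mathcal S'(\mathbb R^n)$. For $s>0$, $\lambda>1$, $(\lambda I-\Delta)^{s+\ln}$ is the Fourier multiplier on $\mathcal S'(\mathbb R^n)$ with symbol $(\lambda+4\pi^2|\xi|^2)^s\ln(\lambda+4\pi^2|\xi|^2)$, and $\mathcal L^{p}_{s+\ln,\lambda}(\mathbb R^n)=\{u\in\mathcal S'(\mathbb R^n):(\lambda I-\Delta)^{s+\ln}u\in L^p(\mathbb R^n)\}$ with norm $\|u\|_{\mathcal L^{p}_{s+\ln,\lambda}}=\|(\lambda I-\Delta)^{s+\ln}u\|_{L^p}$. The logarithmic Bessel potential space of Opic and Trebels with indices $(2s,1)$ is $$L^p_{2s,1}(\mathbb R^n)=\Bigl\{u\in\mathcal S'(\mathbb R^n):\mathcal F^{-1}\Bigl((1+4\pi^2|\xi|^2)^{s}\bigl(1+\ln(1+4\pi^2|\xi|^2)\bigr)\widehat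 u\Bigr)\in L^p(\mathbb R^n)\Bigr\},$$ normed by the $L^p$-norm of $\mathcal F^{-1}\bigl((1+4\pi^2|\xi|^2)^{s}(1+\ln(1+4\pi^2|\xi|^2))\widehat u\bigr)$. *)

theory Defs
  imports "HOL-Analysis.Analysis" "HOL-Probability.Essential_Supremum"
begin

section \<open>Schwartz functions\<close>

definition partial_deriv :: "'n::finite \<Rightarrow> (real^'n \<Rightarrow> complex) \<Rightarrow> real^'n \<Rightarrow> complex" where
  "partial_deriv j f x = frechet_derivative f (at x) (axis j 1)"

definition iter_partial :: "'n::finite list \<Rightarrow> (real^'n \<Rightarrow> complex) \<Rightarrow> real^'n \<Rightarrow> complex" where
  "iter_partial js f = foldr partial_deriv js f"

text \<open>
  Lists of coordinates play the role of multi-indices.  Total differentiability of all iterated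
  partial derivatives makes each of them continuous, so it amounts to smoothness.
\<close>
definition schwartz :: "(real^'n::finite \<Rightarrow> complex) set" where
  "schwartz = {f. \<forall>js. (\<forall>x. iter_partial js f differentiable (at x)) \<and>
                      (\<forall>k::nat. \<exists>B. \<forall>x. norm x ^ k * norm (iter_partial js f x) \<le> B)}"

definition schwartz_seminorm ::
    "nat \<Rightarrow> 'n::finite list \<Rightarrow> (real^'n \<Rightarrow> complex) \<Rightarrow> real" where
  "schwartz_seminorm k js f = (SUP x. norm x ^ k * norm (iter_partial js f x))"


section \<open>Tempered distributions\<close>

text \<open>
  A distribution is a function on all of \<^typ>\<open>real^'n \<Rightarrow> complex\<close>; requiring it to be
  \<^const>\<open>extensional\<close> makes equality of distributions mean equality on Schwartz functions.
\<close>
definition tempered_distributions :: "((real^'n::finite \<Rightarrow> complex) \<Rightarrow> complex) set" where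
  "tempered_distributions = {u. u \<in> extensional schwartz \<and>
     (\<forall>\<phi>\<in>schwartz. \<forall>\<psi>\<in>schwartz. u (\<lambda>x. \<phi> x + \<psi> x) = u \<phi> + u \<psi>) \<and>
     (\<forall>c. \<forall>\<phi>\<in>schwartz. u (\<lambda>x. c * \<phi> x) = c * u \<phi>) \<and>
     (\<exists>B N. \<forall>\<phi>\<in>schwartz.
        norm (u \<phi>) \<le> B * (\<Sum>k\<le>N. \<Sum>js\<in>{js. length js \<le> N}. schwartz_seminorm k js \<phi>))}"

definition dist_of_fun ::
    "(real^'n::finite \<Rightarrow> complex) \<Rightarrow> (real^'n \<Rightarrow> complex) \<Rightarrow> complex" where
  "dist_of_fun f = (\<lambda>\<phi>\<in>schwartz. \<integral>x. f x * \<phi> x \<partial>lborel)"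


section \<open>Fourier transform and Fourier multipliers\<close>

definition fourier :: "(real^'n::finite \<Rightarrow> complex) \<Rightarrow> real^'n \<Rightarrow> complex" where
  "fourier \<phi> \<xi> = (\<integral>x. \<phi> x * exp (- 2 * of_real pi * \<i> * of_real (x \<bullet> \<xi>)) \<partial>lborel)"

definition inverse_fourier :: "(real^'n::finite \<Rightarrow> complex) \<Rightarrow> real^'n \<Rightarrow> complex" where
  "inverse_fourier \<phi> x = (\<integral>\<xi>. \<phi> \<xi> * exp (2 * of_real pi * \<i> * of_real (x \<bullet> \<xi>)) \<partial>lborel)"

definition fourier_dist ::
    "((real^'n::finite \<Rightarrow> complex) \<Rightarrow> complex) \<Rightarrow> (real^'n \<Rightarrow> complex) \<Rightarrow> complex" where
  "fourier_dist u = (\<lambda>\<phi>\<in>schwartz. u (fourier \<phi>))"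

definition inverse_fourier_dist ::
    "((real^'n::finite \<Rightarrow> complex) \<Rightarrow> complex) \<Rightarrow> (real^'n \<Rightarrow> complex) \<Rightarrow> complex" where
  "inverse_fourier_dist u = (\<lambda>\<phi>\<in>schwartz. u (inverse_fourier \<phi>))"

text \<open>
  Meaningful when \<open>m\<close> is smooth with all derivatives of at most polynomial growth, so
  that multiplication by \<open>m\<close> preserves \<^const>\<open>schwartz\<close>; both symbols below are such.
\<close>
definition mult_dist ::
    "(real^'n::finite \<Rightarrow> real) \<Rightarrow> ((real^'n \<Rightarrow> complex) \<Rightarrow> complex)
       \<Rightarrow> (real^'n \<Rightarrow> complex) \<Rightarrow> complex" where
  "mult_dist m u = (\<lambda>\<phi>\<in>schwartz. u (\<lambda>x. of_real (m x) * \<phi> x))"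

definition fourier_multiplier ::
    "(real^'n::finite \<Rightarrow> real) \<Rightarrow> ((real^'n \<Rightarrow> complex) \<Rightarrow> complex)
       \<Rightarrow> (real^'n \<Rightarrow> complex) \<Rightarrow> complex" where
  "fourier_multiplier m u = inverse_fourier_dist (mult_dist m (fourier_dist u))"


section \<open>Lebesgue spaces\<close>

text \<open>The exponent ranges over \<^typ>\<open>ennreal\<close>, the value \<^term>\<open>top :: ennreal\<close> standing for
  \<open>p = \<infinity>\<close>.\<close>
definition Lp_norm :: "ennreal \<Rightarrow> (real^'n::finite \<Rightarrow> complex) \<Rightarrow> ennreal" where
  "Lp_norm p f =
     (if p = top then esssup lborel (\<lambda>x. ennreal (norm (f x)))
      else (let I = \<integral>\<^sup>+ x. ennreal (norm (f x) powr enn2real p) \<partial>lborel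
            in if I = top then top else ennreal (enn2real I powr (1 / enn2real p))))"

definition Lp :: "ennreal \<Rightarrow> (real^'n::finite \<Rightarrow> complex) set" where
  "Lp p = {f \<in> borel_measurable lborel. Lp_norm p f < top}"

definition in_Lp :: "ennreal \<Rightarrow> ((real^'n::finite \<Rightarrow> complex) \<Rightarrow> complex) \<Rightarrow> bool" where
  "in_Lp p u \<longleftrightarrow> (\<exists>f\<in>Lp p. u = dist_of_fun f)"

text \<open>
  The functions representing \<open>u\<close> agree almost everywhere, so the infimum is their common
  norm; it is \<^term>\<open>top :: ennreal\<close> when \<open>u\<close> does not belong to the Lebesgue space.
\<close>
definition Lp_norm_dist :: "ennreal \<Rightarrow> ((real^'n::finite \<Rightarrow> complex) \<Rightarrow> complex) \<Rightarrow> ennreal" where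
  "Lp_norm_dist p u = (INF f\<in>{f \<in> Lp p. u = dist_of_fun f}. Lp_norm p f)"


section \<open>The two scales of spaces\<close>

definition log_symbol :: "real \<Rightarrow> real \<Rightarrow> real^'n::finite \<Rightarrow> real" where
  "log_symbol s lam \<xi> =
     (lam + 4 * pi\<^sup>2 * (norm \<xi>)\<^sup>2) powr s * ln (lam + 4 * pi\<^sup>2 * (norm \<xi>)\<^sup>2)"

text \<open>The operator \<open>(\<lambda>I - \<Delta>)\<^bsup>s+ln\<^esup>\<close>.\<close>
definition log_bessel_op ::
    "real \<Rightarrow> real \<Rightarrow> ((real^'n::finite \<Rightarrow> complex) \<Rightarrow> complex)
       \<Rightarrow> (real^'n \<Rightarrow> complex) \<Rightarrow> complex" where
  "log_bessel_op s lam u = fourier_multiplier (log_symbol s lam) u"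

definition log_space ::
    "ennreal \<Rightarrow> real \<Rightarrow> real \<Rightarrow> ((real^'n::finite \<Rightarrow> complex) \<Rightarrow> complex) set" where
  "log_space p s lam = {u \<in> tempered_distributions. in_Lp p (log_bessel_op s lam u)}"

definition log_space_norm ::
    "ennreal \<Rightarrow> real \<Rightarrow> real \<Rightarrow> ((real^'n::finite \<Rightarrow> complex) \<Rightarrow> complex) \<Rightarrow> ennreal" where
  "log_space_norm p s lam u = Lp_norm_dist p (log_bessel_op s lam u)"

text \<open>
  The Opic--Trebels space with indices \<open>(\<sigma>, b)\<close> has symbol
  \<open>(1 + 4\<pi>\<^sup>2|\<xi>|\<^sup>2)\<^bsup>\<sigma>/2\<^esup> (1 + ln (1 + 4\<pi>\<^sup>2|\<xi>|\<^sup>2))\<^bsup>b\<^esup>\<close>; only \<open>(\<sigma>, b) = (2s, 1)\<close> is needed, and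
  the parameter below is \<open>s\<close>.
\<close>
definition opic_trebels_symbol :: "real \<Rightarrow> real^'n::finite \<Rightarrow> real" where
  "opic_trebels_symbol s \<xi> =
     (1 + 4 * pi\<^sup>2 * (norm \<xi>)\<^sup>2) powr s * (1 + ln (1 + 4 * pi\<^sup>2 * (norm \<xi>)\<^sup>2))"

definition opic_trebels_space ::
    "ennreal \<Rightarrow> real \<Rightarrow> ((real^'n::finite \<Rightarrow> complex) \<Rightarrow> complex) set" where
  "opic_trebels_space p s =
     {u \<in> tempered_distributions. in_Lp p (fourier_multiplier (opic_trebels_symbol s) u)}"

definition opic_trebels_norm ::
    "ennreal \<Rightarrow> real \<Rightarrow> ((real^'n::finite \<Rightarrow> complex) \<Rightarrow> complex) \<Rightarrow> ennreal" where
  "opic_trebels_norm p s u = Lp_norm_dist p (fourier_multiplier (opic_trebels_symbol s) u)"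

end

theory Submission
  imports Defs "HOL-Probability.Characteristic_Functions" "HOL-Probability.Sinc_Integral"
begin

text \<open>
  Write \<open>t = 4\<pi>\<^sup>2|\<xi>|\<^sup>2\<close>, and let \<open>a = (\<lambda> +
  t)\<^sup>s ln (\<lambda> + t)\<close> and \<open>b = (1 + t)\<^sup>s (1 + ln (1 + t))\<close>
  be the two symbols. For every functional \<open>u\<close>, testing
  \<open>F\<^bsup>-1\<^esup>(b F u)\<close> against \<open>\<phi>\<close> is the same as testing
  \<open>F\<^bsup>-1\<^esup>(a F u)\<close> against \<open>F((b/a)
  F\<^bsup>-1\<^esup>\<phi>)\<close> (lemma \<open>fourier_multiplier_transfer\<close>). Hence
  both the equality of the spaces and the equivalence of the norms follow once
  \<open>b/a\<close> and \<open>a/b\<close> are Fourier multipliers of every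
  \<open>L\<^sup>p\<close> with \<open>1 \<le> p \<le> \<infinity>\<close>.

  Because \<open>p = 1\<close> and \<open>p = \<infinity>\<close> are included, the multipliers
  have to be Fourier transforms of finite measures. Such a measure \<open>\<mu>\<close> acts by
  convolution, which is bounded on \<open>L\<^sup>p\<close> by Jensen's inequality and Tonelli's
  theorem (\<open>Lp_multiplier_measure\<close>), and multipliers are closed under sums and
  products. It therefore suffices to build the two ratios by sums and products from transforms
  of finite positive measures. The source of these is the Gamma integral: \<open>(c +
  t)\<^bsup>-\<beta>\<^esup>\<close> is the Laplace transform in \<open>t\<close> of the density
  \<open>\<tau>\<^bsup>\<beta>-1\<^esup> e\<^bsup>-c\<tau>\<^esup> / \<Gamma>(\<beta>)\<close>,
  and \<open>e\<^bsup>-\<tau>t\<^esup>\<close> is the Fourier transform of a Gaussian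
  probability measure. Thus every positive mixture of such powers with finite mass at \<open>t =
  0\<close> is a multiplier (\<open>Lp_multiplier_bessel_mixture\<close>).

  Besides the powers themselves, three mixtures are enough. For \<open>0 < \<delta> < 1\<close>
  the difference \<open>(\<lambda> + t)\<^sup>\<delta> - (1 + t)\<^sup>\<delta>\<close> is the
  integral of \<open>\<delta> (r + t)\<^bsup>\<delta>-1\<^esup>\<close> over \<open>1 \<le> r
  \<le> \<lambda>\<close>; likewise \<open>L = ln (\<lambda> + t) - ln (1 + t)\<close> is the
  integral of \<open>(r + t)\<^bsup>-1\<^esup>\<close>; and \<open>1 / (d + ln (c + t))\<close>
  is the integral of \<open>e\<^bsup>-dr\<^esup> (c + t)\<^bsup>-r\<^esup>\<close> over \<open>r
  > 0\<close>. The first one shows that \<open>((1 + t)/(\<lambda> + t))\<^sup>\<delta>\<close>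
  and its inverse are multipliers; powers with an arbitrary exponent \<open>s\<close> are
  integer powers of these with \<open>\<delta> = s/N\<close>. The logarithmic factors are
  \<open>(1 + ln (1 + t)) / ln (\<lambda> + t) = 1 + (1 - L) / ln (\<lambda> + t)\<close> and
  \<open>ln (\<lambda> + t) / (1 + ln (1 + t)) = 1 + (L - 1) / (1 + ln (1 + t))\<close>.

  The remaining work is the groundwork for these manipulations: the symbols involved preserve
  the Schwartz class, so does the Fourier transform, and the inversion formula holds for
  functions that are integrable, bounded and continuous and have an integrable transform. The
  last generality is needed because the convolution of a Schwartz function with
  \<open>\<mu>\<close> is identified through its transform.
\<close>

section \<open>Schwartz functions and symbols\<close>

lemma partial_deriv_eq:
  assumes "(f has_derivative D) (at x)"
  shows "partial_deriv j f x = D (axis j 1)"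
  using frechet_derivative_at[OF assms] by (simp add: partial_deriv_def)

text \<open>
  The Schwartz class is the largest set of rapidly decreasing differentiable functions that is
  closed under partial derivatives. Used with the obvious candidate sets, this replaces all
  computations with iterated derivatives.
\<close>
lemma schwartz_coinduct:
  assumes "f \<in> X"
    and "\<And>g x. g \<in> X \<Longrightarrow> g differentiable (at x)"
    and "\<And>g k. g \<in> X \<Longrightarrow> \<exists>B. \<forall>x. norm x ^ k * norm (g x) \<le> B"
    and "\<And>g j. g \<in> X \<Longrightarrow> partial_deriv j g \<in> X"
  shows "f \<in> schwartz"
proof -
  have "iter_partial js f \<in> X" for js
    by (induction js) (auto simp: iter_partial_def assms)
  then show ?thesis
    unfolding schwartz_def using assms(2,3) by blast
qed

lemma schwartz_differentiable: "f \<in> schwartz \<Longrightarrow> f differentiable (at x)"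
  unfolding schwartz_def by (auto simp: iter_partial_def dest: spec[of _ "[]"])

lemma schwartz_decay: "f \<in> schwartz \<Longrightarrow> \<exists>B. \<forall>x. norm x ^ k * norm (f x) \<le> B"
  unfolding schwartz_def by (auto simp: iter_partial_def dest!: spec[of _ "[]"])

lemma schwartz_partial_deriv:
  assumes "f \<in> schwartz" shows "partial_deriv j f \<in> schwartz"
proof -
  have "iter_partial js (partial_deriv j f) = iter_partial (js @ [j]) f" for js
    by (simp add: iter_partial_def)
  then show ?thesis using assms unfolding schwartz_def by auto
qed

lemma schwartz_decay_shifted:
  assumes "f \<in> schwartz"
  shows "\<exists>B\<ge>0. \<forall>x. (1 + norm x) ^ k * norm (f x) \<le> B"
proof -
  obtain B0 Bk where B: "\<And>x. norm (f x) \<le> B0" "\<And>x. norm x ^ k * norm (f x) \<le> Bk"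
    using schwartz_decay[OF assms, of 0] schwartz_decay[OF assms, of k] by auto
  have "(1 + norm x) ^ k * norm (f x) \<le> 2 ^ k * (B0 + Bk)" for x
  proof -
    have "(1 + norm x) ^ k \<le> (2 * max 1 (norm x)) ^ k"
      by (intro power_mono) auto
    also have "\<dots> \<le> 2 ^ k * (1 + norm x ^ k)"
      unfolding power_mult_distrib by (intro mult_left_mono) (auto simp: max_def)
    finally have "(1 + norm x) ^ k * norm (f x) \<le> 2 ^ k * (1 + norm x ^ k) * norm (f x)"
      by (intro mult_right_mono) auto
    also have "\<dots> = 2 ^ k * (norm (f x) + norm x ^ k * norm (f x))"
      by (simp add: algebra_simps)
    also have "\<dots> \<le> 2 ^ k * (B0 + Bk)"
      using B by (intro mult_left_mono add_mono) auto
    finally show ?thesis .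
  qed
  moreover have "0 \<le> 2 ^ k * (B0 + Bk)"
    using order_trans[OF norm_ge_zero B(1)] order_trans[OF _ B(2)[of 0]]
    by (intro mult_nonneg_nonneg add_nonneg_nonneg) auto
  ultimately show ?thesis by blast
qed

text \<open>
  The Fourier symbol of \<open>c I - \<Delta>\<close>.
\<close>
definition laplace_symbol :: "real \<Rightarrow> real^'n::finite \<Rightarrow> real" where
  "laplace_symbol c x = c + 4 * pi\<^sup>2 * (norm x)\<^sup>2"

lemma laplace_symbol_ge: "c \<le> laplace_symbol c x"
  by (simp add: laplace_symbol_def)

lemma laplace_symbol_has_derivative: "(laplace_symbol c has_derivative (\<lambda>h. 8 * pi\<^sup>2 * (x \<bullet> h))) (at x)"
  unfolding laplace_symbol_def power2_norm_eq_inner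
  by (auto intro!: derivative_eq_intros simp: inner_commute)

lemma laplace_symbol_le:
  assumes "c \<ge> 0"
  shows "laplace_symbol c x \<le> (c + 4 * pi\<^sup>2) * (1 + norm x)\<^sup>2"
proof -
  have "c * 1 + 4 * pi\<^sup>2 * (norm x)\<^sup>2 \<le> c * (1 + norm x)\<^sup>2 + 4 * pi\<^sup>2 * (1 + norm x)\<^sup>2"
    using assms by (intro add_mono mult_left_mono power_mono) auto
  then show ?thesis by (simp add: laplace_symbol_def algebra_simps)
qed

text \<open>
  An algebra that contains the coordinates and both symbols of the theorem together with their
  reciprocals. Listing the generators, rather than defining smoothness with polynomial growth,
  makes closure under partial derivatives and growth bounds plain rule inductions: the
  derivative of each generator is a polynomial in generators. The bound \<open>c \<ge> 1\<close>
  keeps the logarithms nonnegative.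
\<close>
inductive_set symbols :: "(real^'n::finite \<Rightarrow> complex) set" where
  const: "(\<lambda>_. c) \<in> symbols"
| coord: "(\<lambda>x. of_real (x $ j)) \<in> symbols"
| powr: "c \<ge> 1 \<Longrightarrow> (\<lambda>x. of_real (laplace_symbol c x powr r)) \<in> symbols"
| ln: "c \<ge> 1 \<Longrightarrow> (\<lambda>x. of_real (ln (laplace_symbol c x))) \<in> symbols"
| inv: "c \<ge> 1 \<Longrightarrow> d + ln c > 0 \<Longrightarrow> (\<lambda>x. of_real (1 / (d + ln (laplace_symbol c x)))) \<in> symbols"
| add: "f \<in> symbols \<Longrightarrow> g \<in> symbols \<Longrightarrow> (\<lambda>x. f x + g x) \<in> symbols"
| mult: "f \<in> symbols \<Longrightarrow> g \<in> symbols \<Longrightarrow> (\<lambda>x. f x * g x) \<in> symbols"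

lemma symbols_cmult: "f \<in> symbols \<Longrightarrow> (\<lambda>x. c * f x) \<in> symbols"
  by (rule symbols.mult[OF symbols.const])

lemma partial_deriv_add:
  assumes "f differentiable (at x)" "g differentiable (at x)"
  shows "partial_deriv j (\<lambda>x. f x + g x) x = partial_deriv j f x + partial_deriv j g x"
proof -
  obtain D E where "(f has_derivative D) (at x)" "(g has_derivative E) (at x)"
    using assms by (auto simp: differentiable_def)
  then show ?thesis
    using partial_deriv_eq[OF has_derivative_add, of f D x g E j] by (simp add: partial_deriv_eq)
qed

lemma partial_deriv_mult:
  assumes "f differentiable (at x)" "g differentiable (at x)"
  shows "partial_deriv j (\<lambda>x. f x * g x) x = f x * partial_deriv j g x + partial_deriv j f x * g x"
proof -
  obtain D E where "(f has_derivative D) (at x)" "(g has_derivative E) (at x)"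
    using assms by (auto simp: differentiable_def)
  then show ?thesis
    using partial_deriv_eq[OF has_derivative_mult, of f D x g E j] by (simp add: partial_deriv_eq)
qed

text \<open>
  All nontrivial generators are functions of \<open>|x|\<^sup>2\<close>, so their gradient at
  \<open>x\<close> is a scalar multiple of \<open>x\<close>.
\<close>
lemma symbols_real_derivative:
  assumes "\<And>x. (f has_derivative (\<lambda>h. f' x * (x \<bullet> h))) (at x)"
    and "(\<lambda>x. of_real (f' x)) \<in> symbols"
  shows "(\<forall>x. (\<lambda>x. complex_of_real (f x)) differentiable (at x)) \<and>
    (\<forall>j. partial_deriv j (\<lambda>x. complex_of_real (f x)) \<in> symbols)"
proof -
  have *: "((\<lambda>x. complex_of_real (f x)) has_derivative (\<lambda>h. of_real (f' x * (x \<bullet> h)))) (at x)" for x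
    using has_derivative_of_real[OF assms(1)] .
  have "partial_deriv j (\<lambda>x. complex_of_real (f x)) = (\<lambda>x. of_real (f' x) * of_real (x $ j))" for j
    by (rule ext, subst partial_deriv_eq[OF *]) (simp add: inner_axis)
  with * show ?thesis
    using symbols.mult[OF assms(2) symbols.coord] by (auto simp del: of_real_mult simp: differentiable_def)
qed

lemma symbols_smooth:
  fixes f :: "real^'n::finite \<Rightarrow> complex"
  assumes "f \<in> symbols"
  shows "(\<forall>x. f differentiable (at x)) \<and> (\<forall>j. partial_deriv j f \<in> symbols)"
  using assms
proof (induction rule: symbols.induct)
  case (const c)
  have "partial_deriv j (\<lambda>_::real^'n. c) = (\<lambda>_. 0)" for j
    by (rule ext, subst partial_deriv_eq[OF has_derivative_const]) simp
  then show ?case using symbols.const by auto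
next
  case (coord i)
  have *: "((\<lambda>x::real^'n. complex_of_real (x $ i)) has_derivative (\<lambda>h. of_real (h $ i))) (at x)" for x
    by (intro has_derivative_of_real bounded_linear_imp_has_derivative bounded_linear_vec_nth)
  have "partial_deriv j (\<lambda>x. complex_of_real (x $ i)) = (\<lambda>_. of_real (axis j 1 $ i))" for j
    by (rule ext, subst partial_deriv_eq[OF *]) simp
  then show ?case using * symbols.const by (auto simp: differentiable_def)
next
  case (powr c r)
  have pos: "laplace_symbol c x > 0" for x :: "real^'n"
    using powr laplace_symbol_ge[of c x] by simp
  show ?case
  proof (rule symbols_real_derivative)
    show "((\<lambda>x. laplace_symbol c x powr r) has_derivative (\<lambda>h. (8 * pi\<^sup>2 * r * laplace_symbol c x powr (r - 1)) * (x \<bullet> h))) (at x)" for x :: "real^'n"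
      by (rule derivative_eq_intros laplace_symbol_has_derivative has_derivative_const refl pos)+ (use pos[of x] in \<open>simp_all add: powr_diff field_simps fun_eq_iff\<close>)
    show "(\<lambda>x::real^'n. complex_of_real (8 * pi\<^sup>2 * r * laplace_symbol c x powr (r - 1))) \<in> symbols"
      using symbols_cmult[OF symbols.powr[OF powr, of "r-1"], of "of_real (8 * pi\<^sup>2 * r)"] by simp
  qed
next
  case (ln c)
  have pos: "laplace_symbol c x > 0" for x :: "real^'n"
    using ln laplace_symbol_ge[of c x] by simp
  show ?case
  proof (rule symbols_real_derivative)
    show "((\<lambda>x. ln (laplace_symbol c x)) has_derivative (\<lambda>h. (8 * pi\<^sup>2 * laplace_symbol c x powr (-1)) * (x \<bullet> h))) (at x)" for x :: "real^'n"
      by (rule derivative_eq_intros laplace_symbol_has_derivative refl pos)+ (use pos[of x] in \<open>simp add: powr_minus field_simps\<close>)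
    show "(\<lambda>x::real^'n. complex_of_real (8 * pi\<^sup>2 * laplace_symbol c x powr (- 1))) \<in> symbols"
      using symbols_cmult[OF symbols.powr[OF ln, of "-1"], of "of_real (8 * pi\<^sup>2)"] by simp
  qed
next
  case (inv c d)
  have pos: "laplace_symbol c x > 0" for x :: "real^'n"
    using inv laplace_symbol_ge[of c x] by simp
  have pos': "d + ln (laplace_symbol c x) > 0" for x :: "real^'n"
    using inv laplace_symbol_ge[of c x] by (smt (verit) ln_le_cancel_iff)
  let ?v = "\<lambda>x::real^'n. 1 / (d + ln (laplace_symbol c x))"
  show ?case
  proof (rule symbols_real_derivative)
    show "(?v has_derivative (\<lambda>h. (- 8 * pi\<^sup>2 * (laplace_symbol c x powr (-1) * (?v x * ?v x))) * (x \<bullet> h))) (at x)" for x :: "real^'n"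
      by (rule derivative_eq_intros laplace_symbol_has_derivative refl pos)+ (use pos[of x] pos'[of x] in \<open>simp_all add: powr_minus divide_simps\<close>)
    show "(\<lambda>x::real^'n. complex_of_real (- 8 * pi\<^sup>2 * (laplace_symbol c x powr (- 1) * (?v x * ?v x)))) \<in> symbols"
      using symbols_cmult[OF symbols.mult[OF symbols.powr[OF inv(1), of "-1"]
            symbols.mult[OF symbols.inv[OF inv] symbols.inv[OF inv]]], of "of_real (- 8 * pi\<^sup>2)"]
      by simp
  qed
next
  case (add f g)
  then have "partial_deriv j (\<lambda>x. f x + g x) = (\<lambda>x. partial_deriv j f x + partial_deriv j g x)" for j
    by (simp add: partial_deriv_add fun_eq_iff)
  then show ?case using add by (auto intro!: symbols.add)
next
  case (mult f g)
  then have "partial_deriv j (\<lambda>x. f x * g x) = (\<lambda>x. f x * partial_deriv j g x + partial_deriv j f x * g x)" for j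
    by (simp add: partial_deriv_mult fun_eq_iff)
  then show ?case using mult by (auto intro!: symbols.add symbols.mult)
qed

lemma symbols_growth:
  fixes f :: "real^'n::finite \<Rightarrow> complex"
  assumes "f \<in> symbols"
  shows "\<exists>k B. \<forall>x. norm (f x) \<le> B * (1 + norm x) ^ k"
  using assms
proof (induction rule: symbols.induct)
  case (const c)
  show ?case by (intro exI[of _ 0] exI[of _ "norm c"]) simp
next
  case (coord j)
  have "\<bar>x $ j\<bar> \<le> 1 + norm x" for x :: "real^'n"
    using component_le_norm_cart[of x j] by linarith
  then show ?case by (intro exI[of _ 1] exI[of _ 1]) simp
next
  case (powr c r)
  obtain N :: nat where N: "r \<le> real N" using real_arch_simple by blast
  show ?case
  proof (intro exI allI)
    fix x :: "real^'n"
    have q: "1 \<le> laplace_symbol c x" using powr laplace_symbol_ge[of c x] by simp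
    have "laplace_symbol c x powr r \<le> laplace_symbol c x ^ N"
      using powr_mono[OF N q] q by (simp add: powr_realpow)
    also have "\<dots> \<le> ((c + 4 * pi\<^sup>2) * (1 + norm x)\<^sup>2) ^ N"
      using laplace_symbol_le[of c x] powr q by (intro power_mono) auto
    also have "\<dots> = (c + 4 * pi\<^sup>2) ^ N * (1 + norm x) ^ (2 * N)"
      by (simp add: power_mult_distrib power_mult)
    finally show "norm (complex_of_real (laplace_symbol c x powr r)) \<le> (c + 4 * pi\<^sup>2) ^ N * (1 + norm x) ^ (2 * N)"
      by simp
  qed
next
  case (ln c)
  show ?case
  proof (intro exI allI)
    fix x :: "real^'n"
    have q: "1 \<le> laplace_symbol c x" using ln laplace_symbol_ge[of c x] by simp
    have "\<bar>ln (laplace_symbol c x)\<bar> \<le> laplace_symbol c x" using q ln_bound[of "laplace_symbol c x"] by simp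
    also have "\<dots> \<le> (c + 4 * pi\<^sup>2) * (1 + norm x) ^ 2" using laplace_symbol_le[of c x] ln by simp
    finally show "norm (complex_of_real (ln (laplace_symbol c x))) \<le> (c + 4 * pi\<^sup>2) * (1 + norm x) ^ 2" by simp
  qed
next
  case (inv c d)
  have "ln c \<le> ln (laplace_symbol c x)" for x :: "real^'n"
    using laplace_symbol_ge[of c x] inv by simp
  then have "norm (complex_of_real (1 / (d + ln (laplace_symbol c x)))) \<le> 1 / (d + ln c) * (1 + norm x) ^ 0" for x :: "real^'n"
    using inv(2) by (simp add: norm_divide abs_of_pos del: of_real_add of_real_divide) (smt (verit) frac_le)
  then show ?case by blast
next
  case (add f g)
  then obtain k B l C where *: "\<And>x. norm (f x) \<le> B * (1 + norm x) ^ k" "\<And>x. norm (g x) \<le> C * (1 + norm x) ^ l"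
    by blast
  have nn: "0 \<le> B" "0 \<le> C" using order_trans[OF norm_ge_zero *(1)[of 0]] order_trans[OF norm_ge_zero *(2)[of 0]] by auto
  have "norm (f x + g x) \<le> (B + C) * (1 + norm x) ^ (k + l)" for x
  proof -
    have "norm (f x + g x) \<le> B * (1 + norm x) ^ k + C * (1 + norm x) ^ l"
      using norm_triangle_ineq *[of x] by (smt (verit))
    also have "\<dots> \<le> B * (1 + norm x) ^ (k + l) + C * (1 + norm x) ^ (k + l)"
      using nn by (intro add_mono mult_left_mono power_increasing) auto
    finally show ?thesis by (simp add: algebra_simps)
  qed
  then show ?case by blast
next
  case (mult f g)
  then obtain k B l C where *: "\<And>x. norm (f x) \<le> B * (1 + norm x) ^ k" "\<And>x. norm (g x) \<le> C * (1 + norm x) ^ l"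
    by blast
  have "norm (f x * g x) \<le> (B * C) * (1 + norm x) ^ (k + l)" for x
  proof -
    have "norm (f x * g x) \<le> (B * (1 + norm x) ^ k) * (C * (1 + norm x) ^ l)"
      unfolding norm_mult by (rule mult_mono[OF * order_trans[OF norm_ge_zero *(1)]]) simp
    then show ?thesis by (simp add: power_add algebra_simps)
  qed
  then show ?case by blast
qed

text \<open>
  By the product rule the derivative of a product of a symbol and a Schwartz function is a sum
  of two such products, so the sums of such products form a candidate set for
  \<open>schwartz_coinduct\<close>.
\<close>
inductive_set symbol_combinations :: "(real^'n::finite \<Rightarrow> complex) set" where
  prod: "f \<in> symbols \<Longrightarrow> \<phi> \<in> schwartz \<Longrightarrow> (\<lambda>x. f x * \<phi> x) \<in> symbol_combinations"
| add: "f \<in> symbol_combinations \<Longrightarrow> g \<in> symbol_combinations \<Longrightarrow> (\<lambda>x. f x + g x) \<in> symbol_combinations"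

lemma symbol_combinations_smooth:
  assumes "f \<in> symbol_combinations"
  shows "(\<forall>x. f differentiable (at x)) \<and> (\<forall>j. partial_deriv j f \<in> symbol_combinations)"
  using assms
proof (induction rule: symbol_combinations.induct)
  case (prod f \<phi>)
  then have "partial_deriv j (\<lambda>x. f x * \<phi> x) = (\<lambda>x. f x * partial_deriv j \<phi> x + partial_deriv j f x * \<phi> x)" for j
    by (simp add: partial_deriv_mult symbols_smooth schwartz_differentiable fun_eq_iff)
  then show ?case
    using prod by (auto intro!: symbol_combinations.intros
      simp: symbols_smooth schwartz_differentiable schwartz_partial_deriv)
next
  case (add f g)
  then have "partial_deriv j (\<lambda>x. f x + g x) = (\<lambda>x. partial_deriv j f x + partial_deriv j g x)" for j
    by (simp add: partial_deriv_add fun_eq_iff)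
  then show ?case using add by (auto intro!: symbol_combinations.add)
qed

lemma symbol_combinations_decay:
  assumes "f \<in> symbol_combinations"
  shows "\<exists>B. \<forall>x. norm x ^ k * norm (f x) \<le> B"
  using assms
proof (induction rule: symbol_combinations.induct)
  case (prod f \<phi>)
  obtain l C where C: "\<And>x. norm (f x) \<le> C * (1 + norm x) ^ l"
    using symbols_growth[OF prod(1)] by blast
  obtain B where B: "B \<ge> 0" "\<And>x. (1 + norm x) ^ (k + l) * norm (\<phi> x) \<le> B"
    using schwartz_decay_shifted[OF prod(2), of "k + l"] by blast
  have C0: "0 \<le> C" using order_trans[OF norm_ge_zero C[of 0]] by simp
  have "norm x ^ k * norm (f x * \<phi> x) \<le> C * B" for x
  proof -
    have "norm x ^ k * norm (f x * \<phi> x) \<le> (1 + norm x) ^ k * ((C * (1 + norm x) ^ l) * norm (\<phi> x))"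
      unfolding norm_mult using C0 by (intro mult_mono power_mono C) auto
    also have "\<dots> = C * ((1 + norm x) ^ (k + l) * norm (\<phi> x))" by (simp add: power_add)
    also have "\<dots> \<le> C * B" using B C0 by (intro mult_left_mono)
    finally show ?thesis .
  qed
  then show ?case by blast
next
  case (add f g)
  then obtain B C where "\<And>x. norm x ^ k * norm (f x) \<le> B" "\<And>x. norm x ^ k * norm (g x) \<le> C" by blast
  then have "norm x ^ k * norm (f x + g x) \<le> B + C" for x
    using mult_left_mono[OF norm_triangle_ineq, of "norm x ^ k" "f x" "g x"]
    by (smt (verit, best) distrib_left norm_ge_zero zero_le_power)
  then show ?case by blast
qed

lemma symbol_combinations_schwartz: "f \<in> symbol_combinations \<Longrightarrow> f \<in> schwartz"
  by (rule schwartz_coinduct[where X = symbol_combinations])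
    (auto simp: symbol_combinations_smooth symbol_combinations_decay)

lemma schwartz_symbol_mult: "f \<in> symbols \<Longrightarrow> \<phi> \<in> schwartz \<Longrightarrow> (\<lambda>x. f x * \<phi> x) \<in> schwartz"
  by (rule symbol_combinations_schwartz[OF symbol_combinations.prod])

lemma schwartz_cmult: "\<phi> \<in> schwartz \<Longrightarrow> (\<lambda>x. c * \<phi> x) \<in> schwartz"
  by (rule schwartz_symbol_mult[OF symbols.const])

lemma schwartz_reflect:
  assumes "\<phi> \<in> schwartz" shows "(\<lambda>x. \<phi> (- x)) \<in> schwartz"
proof (rule schwartz_coinduct[where X = "{\<lambda>x. \<psi> (- x) |\<psi>. \<psi> \<in> schwartz}"])
  have D: "((\<lambda>x. \<psi> (- x)) has_derivative (\<lambda>h. frechet_derivative \<psi> (at (- x)) (- h))) (at x)"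
    if "\<psi> \<in> schwartz" for \<psi> :: "real^'a \<Rightarrow> complex" and x
    using has_derivative_compose[of uminus uminus x UNIV \<psi>, OF _
        schwartz_differentiable[OF that, unfolded frechet_derivative_works]]
    by (auto intro!: derivative_eq_intros)
  show "g differentiable (at x)" if "g \<in> {\<lambda>x. \<psi> (- x) |\<psi>. \<psi> \<in> schwartz}" for g :: "real^'a \<Rightarrow> complex" and x
    using that D by (auto simp: differentiable_def)
  show "partial_deriv j g \<in> {\<lambda>x. \<psi> (- x) |\<psi>. \<psi> \<in> schwartz}" if "g \<in> {\<lambda>x. \<psi> (- x) |\<psi>. \<psi> \<in> schwartz}" for g :: "real^'a \<Rightarrow> complex" and j
  proof -
    obtain \<psi> where \<psi>: "\<psi> \<in> schwartz" "g = (\<lambda>x. \<psi> (- x))" using \<open>g \<in> _\<close> by blast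
    have "partial_deriv j g = (\<lambda>x. (-1) * partial_deriv j \<psi> (- x))"
    proof
      fix x
      have "linear (frechet_derivative \<psi> (at (- x)))"
        using linear_frechet_derivative[OF schwartz_differentiable[OF \<psi>(1)]] .
      then show "partial_deriv j g x = (-1) * partial_deriv j \<psi> (- x)"
        unfolding \<psi>(2) partial_deriv_eq[OF D[OF \<psi>(1)]] by (simp add: partial_deriv_def linear_neg)
    qed
    moreover have "(\<lambda>x. (-1) * partial_deriv j \<psi> x) \<in> schwartz"
      by (intro schwartz_cmult schwartz_partial_deriv \<psi>)
    ultimately show ?thesis by auto
  qed
  show "\<exists>B. \<forall>x. norm x ^ k * norm (g x) \<le> B" if "g \<in> {\<lambda>x. \<psi> (- x) |\<psi>. \<psi> \<in> schwartz}" for g :: "real^'a \<Rightarrow> complex" and k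
  proof -
    obtain \<psi> where \<psi>: "\<psi> \<in> schwartz" "g = (\<lambda>x. \<psi> (- x))" using \<open>g \<in> _\<close> by blast
    obtain B where "\<And>x. norm x ^ k * norm (\<psi> x) \<le> B" using schwartz_decay[OF \<psi>(1), of k] by blast
    then have "norm x ^ k * norm (g x) \<le> B" for x unfolding \<psi>(2) by (metis norm_minus_cancel)
    then show ?thesis by blast
  qed
qed (use assms in auto)

section \<open>Gaussians and the Fourier inversion formula\<close>

lemma lborel_integral_affine:
  fixes f :: "'a::euclidean_space \<Rightarrow> 'b::{banach, second_countable_topology}"
  assumes [measurable]: "f \<in> borel_measurable borel" and c: "c \<noteq> 0"
  shows "(\<integral>x. f x \<partial>lborel) = (\<bar>c\<bar> ^ DIM('a)) *\<^sub>R (\<integral>x. f (t + c *\<^sub>R x) \<partial>lborel)"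
  by (subst lborel_affine[OF c, of t], subst integral_density)
    (simp_all add: integral_distr)

lemma lborel_nn_integral_affine:
  fixes f :: "'a::euclidean_space \<Rightarrow> ennreal"
  assumes [measurable]: "f \<in> borel_measurable borel" and c: "c \<noteq> 0"
  shows "(\<integral>\<^sup>+x. f x \<partial>lborel) = ennreal (\<bar>c\<bar> ^ DIM('a)) * (\<integral>\<^sup>+x. f (t + c *\<^sub>R x) \<partial>lborel)"
  by (subst lborel_affine[OF c, of t], subst nn_integral_density)
    (simp_all add: nn_integral_distr nn_integral_cmult)

lemma lborel_integrable_affine:
  fixes f :: "'a::euclidean_space \<Rightarrow> 'b::{banach, second_countable_topology}"
  assumes f: "integrable lborel f" and c: "c \<noteq> 0"
  shows "integrable lborel (\<lambda>x. f (t + c *\<^sub>R x))"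
proof -
  have [measurable]: "f \<in> borel_measurable borel" using f by auto
  show ?thesis
    using f lborel_nn_integral_affine[of "\<lambda>x. ennreal (norm (f x))" c t] c
    unfolding integrable_iff_bounded by (auto simp: ennreal_mult_less_top)
qed

lemma
  fixes f :: "'a::euclidean_space \<Rightarrow> real \<Rightarrow> 'c::{real_normed_field, banach, second_countable_topology}"
  assumes int: "\<And>b. b \<in> Basis \<Longrightarrow> integrable lborel (f b)"
  shows integrable_prod_coordinates: "integrable lborel (\<lambda>x. \<Prod>b\<in>Basis. f b (x \<bullet> b))"
    and integral_prod_coordinates:
      "(\<integral>x. (\<Prod>b\<in>Basis. f b (x \<bullet> b)) \<partial>lborel) = (\<Prod>b\<in>Basis. \<integral>x. f b x \<partial>lborel)"
proof -
  interpret product_sigma_finite "\<lambda>_::'a. lborel :: real measure" ..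
  have [measurable]: "(\<lambda>x. \<Prod>b\<in>Basis. f b (x \<bullet> b)) \<in> borel_measurable borel"
    using int by (intro borel_measurable_prod measurable_compose[OF _ borel_measurable_integrable[OF int], simplified]) auto
  have eq: "(\<Prod>b\<in>Basis. f b ((\<Sum>b\<in>Basis. g b *\<^sub>R b) \<bullet> b)) = (\<Prod>b\<in>Basis. f b (g b))" for g :: "'a \<Rightarrow> real"
    by (rule prod.cong) simp_all
  show "integrable lborel (\<lambda>x. \<Prod>b\<in>Basis. f b (x \<bullet> b))"
    by (subst lborel_eq, subst integrable_distr_eq) (auto simp: eq intro!: product_integrable_prod int)
  show "(\<integral>x. (\<Prod>b\<in>Basis. f b (x \<bullet> b)) \<partial>lborel) = (\<Prod>b\<in>Basis. \<integral>x. f b x \<partial>lborel)"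
    by (subst lborel_eq, subst integral_distr) (auto simp: eq intro!: product_integral_prod int)
qed

text \<open>
  The Gaussian that is its own Fourier transform and has integral one.
\<close>
definition gauss :: "'a::euclidean_space \<Rightarrow> real" where
  "gauss x = exp (- pi * (norm x)\<^sup>2)"

lemma gauss_nonneg [simp]: "gauss x \<ge> 0"
  by (simp add: gauss_def)

lemma borel_measurable_gauss [measurable]: "gauss \<in> borel_measurable borel"
  unfolding gauss_def[abs_def] by measurable

lemma integrable_gauss_real: "integrable lborel (\<lambda>x::real. exp (- pi * x\<^sup>2))"
proof -
  have "normal_density 0 (1 / sqrt (2 * pi)) = (\<lambda>x. exp (- (pi * x\<^sup>2)))"
    by (auto simp: normal_density_def power_divide fun_eq_iff)
  then show ?thesis using integrable_normal_density[of "1 / sqrt (2 * pi)" 0] by simp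
qed

text \<open>
  The rescaling \<open>y = \<surd>(2\<pi>) x\<close> turns the characteristic function of the
  standard normal distribution into this.
\<close>
lemma fourier_gauss_real:
  "(\<integral>x. complex_of_real (exp (- pi * x\<^sup>2)) * cis (2 * pi * (x * \<xi>)) \<partial>lborel) = of_real (exp (- pi * \<xi>\<^sup>2))"
proof -
  let ?t = "sqrt (2 * pi) * \<xi>"
  have "char std_normal_distribution ?t =
      (\<integral>y. of_real (std_normal_density y) * cis (?t * y) \<partial>lborel)"
    unfolding char_def by (subst integral_density) (auto simp: cis_conv_exp scaleR_conv_of_real)
  also have "\<dots> = sqrt (2 * pi) *\<^sub>R
      (\<integral>x. of_real (std_normal_density (0 + sqrt (2 * pi) * x)) * cis (?t * (0 + sqrt (2 * pi) * x)) \<partial>lborel)"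
    by (subst lborel_integral_real_affine[where c = "sqrt (2 * pi)" and t = 0]) auto
  also have "\<dots> = (\<integral>x. sqrt (2 * pi) *\<^sub>R
      (of_real (std_normal_density (0 + sqrt (2 * pi) * x)) * cis (?t * (0 + sqrt (2 * pi) * x))) \<partial>lborel)"
    by simp
  also have "\<dots> = (\<integral>x. complex_of_real (exp (- pi * x\<^sup>2)) * cis (2 * pi * (x * \<xi>)) \<partial>lborel)"
  proof (rule Bochner_Integration.integral_cong[OF refl])
    fix x :: real
    have "?t * (0 + sqrt (2 * pi) * x) = 2 * pi * (x * \<xi>)"
      by (simp add: algebra_simps flip: real_sqrt_mult)
    moreover have "sqrt (2 * pi) * std_normal_density (0 + sqrt (2 * pi) * x) = exp (- pi * x\<^sup>2)"
      by (simp add: std_normal_density_def power_mult_distrib)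
    ultimately show "sqrt (2 * pi) *\<^sub>R
      (of_real (std_normal_density (0 + sqrt (2 * pi) * x)) * cis (?t * (0 + sqrt (2 * pi) * x))) =
      complex_of_real (exp (- pi * x\<^sup>2)) * cis (2 * pi * (x * \<xi>))"
      by (metis mult.assoc of_real_mult scaleR_conv_of_real)
  qed
  finally have "(\<integral>x. complex_of_real (exp (- pi * x\<^sup>2)) * cis (2 * pi * (x * \<xi>)) \<partial>lborel) =
      of_real (exp (- (?t\<^sup>2) / 2))"
    by (simp add: char_std_normal_distribution)
  also have "- (?t\<^sup>2) / 2 = - pi * \<xi>\<^sup>2"
    by (simp add: power_mult_distrib)
  finally show ?thesis .
qed

lemma cis_sum: "finite A \<Longrightarrow> cis (\<Sum>a\<in>A. f a) = (\<Prod>a\<in>A. cis (f a))"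
  by (induction A rule: finite_induct) (simp_all add: cis_mult[symmetric])

lemma gauss_prod: "gauss x = (\<Prod>b\<in>Basis. exp (- pi * (x \<bullet> b)\<^sup>2))"
proof -
  have "(norm x)\<^sup>2 = (\<Sum>b\<in>Basis. (x \<bullet> b)\<^sup>2)"
    unfolding power2_norm_eq_inner using euclidean_inner[of x x] by (simp add: power2_eq_square)
  then have "- pi * (norm x)\<^sup>2 = (\<Sum>b\<in>Basis. - pi * (x \<bullet> b)\<^sup>2)"
    by (simp add: sum_distrib_left sum_negf)
  then show ?thesis by (simp only: gauss_def exp_sum finite_Basis)
qed

lemma integrable_gauss: "integrable lborel (gauss :: 'a::euclidean_space \<Rightarrow> real)"
  unfolding gauss_prod[abs_def] by (rule integrable_prod_coordinates) (rule integrable_gauss_real)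

lemma borel_measurable_cis [measurable]: "cis \<in> borel_measurable borel"
  by (intro borel_measurable_continuous_onI continuous_on_cis continuous_on_id)

lemma integrable_mult_cis:
  fixes f :: "'a \<Rightarrow> complex"
  assumes "integrable M f" and [measurable]: "g \<in> borel_measurable M"
  shows "integrable M (\<lambda>x. f x * cis (g x))"
  by (rule Bochner_Integration.integrable_bound[OF assms(1)]) (use assms(1) in \<open>auto simp: norm_mult\<close>)

lemma fourier_gauss:
  fixes \<xi> :: "'a::euclidean_space"
  shows "(\<integral>x. complex_of_real (gauss x) * cis (2 * pi * (x \<bullet> \<xi>)) \<partial>lborel) = of_real (gauss \<xi>)"
proof -
  let ?f = "\<lambda>b x. complex_of_real (exp (- pi * x\<^sup>2)) * cis (2 * pi * (x * (\<xi> \<bullet> b)))"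
  have "complex_of_real (gauss x) * cis (2 * pi * (x \<bullet> \<xi>)) = (\<Prod>b\<in>Basis. ?f b (x \<bullet> b))" for x
    unfolding gauss_prod euclidean_inner[of x \<xi>] sum_distrib_left by (simp add: cis_sum prod.distrib)
  then have "(\<integral>x. complex_of_real (gauss x) * cis (2 * pi * (x \<bullet> \<xi>)) \<partial>lborel) =
      (\<Prod>b\<in>Basis. \<integral>x. ?f b x \<partial>lborel)"
    by (simp only:) (rule integral_prod_coordinates, rule integrable_mult_cis,
      rule integrable_of_real[OF integrable_gauss_real], measurable)
  then show ?thesis by (simp only: fourier_gauss_real gauss_prod of_real_prod)
qed

lemma integral_gauss: "(\<integral>x. gauss (x::'a::euclidean_space) \<partial>lborel) = 1"
proof -
  have "complex_of_real (\<integral>x. gauss (x::'a) \<partial>lborel) = 1"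
    using fourier_gauss[of "0::'a"] by (simp add: gauss_def)
  then show ?thesis using of_real_eq_1_iff by blast
qed

text \<open>
  The damping factor \<open>gauss (\<epsilon> \<xi>)\<close> makes the double integral
  absolutely convergent. After exchanging the integrals, the inner one is the transform of a
  dilated Gaussian, which is an approximate identity at \<open>x\<close>.
\<close>
lemma fourier_inversion_gauss:
  fixes f :: "'a::euclidean_space \<Rightarrow> complex"
  assumes f: "integrable lborel f" and \<epsilon>: "\<epsilon> > 0"
  shows "(\<integral>\<xi>. (\<integral>y. f y * cis (2 * pi * (y \<bullet> \<xi>)) \<partial>lborel) * cis (- (2 * pi * (x \<bullet> \<xi>))) * gauss (\<epsilon> *\<^sub>R \<xi>) \<partial>lborel)
    = (\<integral>w. f (x + \<epsilon> *\<^sub>R w) * gauss w \<partial>lborel)"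
proof -
  have [measurable]: "f \<in> borel_measurable borel" using f by auto
  have scaled: "integrable lborel (\<lambda>\<xi>::'a. gauss (\<epsilon> *\<^sub>R \<xi>))"
    using lborel_integrable_affine[OF integrable_gauss, of \<epsilon> 0] \<epsilon> by simp
  let ?g = "\<lambda>\<xi> y. f y * cis (2 * pi * ((y - x) \<bullet> \<xi>)) * gauss (\<epsilon> *\<^sub>R \<xi>)"
  have inner: "(\<integral>\<xi>. ?g \<xi> y \<partial>lborel) = inverse \<epsilon> ^ DIM('a) *\<^sub>R (f y * gauss (inverse \<epsilon> *\<^sub>R (y - x)))" for y
  proof -
    have "(\<integral>\<xi>. ?g \<xi> y \<partial>lborel) = \<bar>inverse \<epsilon>\<bar> ^ DIM('a) *\<^sub>R (\<integral>\<xi>. ?g (0 + inverse \<epsilon> *\<^sub>R \<xi>) y \<partial>lborel)"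
      using \<epsilon> by (intro lborel_integral_affine) auto
    also have "(\<lambda>\<xi>. ?g (0 + inverse \<epsilon> *\<^sub>R \<xi>) y) = (\<lambda>\<xi>. f y * (gauss \<xi> * cis (2 * pi * (\<xi> \<bullet> (inverse \<epsilon> *\<^sub>R (y - x))))))"
      using \<epsilon> by (simp add: fun_eq_iff inner_commute)
    also have "(\<integral>\<xi>. f y * (gauss \<xi> * cis (2 * pi * (\<xi> \<bullet> (inverse \<epsilon> *\<^sub>R (y - x))))) \<partial>lborel) =
        f y * gauss (inverse \<epsilon> *\<^sub>R (y - x))"
      by (simp only: integral_mult_right_zero fourier_gauss)
    finally show ?thesis using \<epsilon> by simp
  qed
  have "(\<integral>\<xi>. (\<integral>y. f y * cis (2 * pi * (y \<bullet> \<xi>)) \<partial>lborel) * cis (- (2 * pi * (x \<bullet> \<xi>))) * gauss (\<epsilon> *\<^sub>R \<xi>) \<partial>lborel)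
      = (\<integral>\<xi>. (\<integral>y. ?g \<xi> y \<partial>lborel) \<partial>lborel)"
  proof (rule Bochner_Integration.integral_cong[OF refl])
    fix \<xi> :: 'a
    have "cis (2 * pi * ((y - x) \<bullet> \<xi>)) = cis (2 * pi * (y \<bullet> \<xi>)) * cis (- (2 * pi * (x \<bullet> \<xi>)))" for y
      by (simp add: cis_mult inner_diff_left right_diff_distrib)
    then have "(\<integral>y. ?g \<xi> y \<partial>lborel) =
        (\<integral>y. f y * cis (2 * pi * (y \<bullet> \<xi>)) * (cis (- (2 * pi * (x \<bullet> \<xi>))) * gauss (\<epsilon> *\<^sub>R \<xi>)) \<partial>lborel)"
      by (simp only: mult.assoc)
    then show "(\<integral>y. f y * cis (2 * pi * (y \<bullet> \<xi>)) \<partial>lborel) * cis (- (2 * pi * (x \<bullet> \<xi>))) * gauss (\<epsilon> *\<^sub>R \<xi>)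
        = (\<integral>y. ?g \<xi> y \<partial>lborel)"
      by (simp only: integral_mult_left_zero) (simp only: mult.assoc)
  qed
  also have "\<dots> = (\<integral>y. (\<integral>\<xi>. ?g \<xi> y \<partial>lborel) \<partial>lborel)"
  proof (rule lborel_pair.Fubini_integral[symmetric])
    have "integrable (lborel \<Otimes>\<^sub>M lborel) (\<lambda>(\<xi>::'a, y). f y * gauss (\<epsilon> *\<^sub>R \<xi>))"
    proof (rule lborel_pair.Fubini_integrable)
      have "integrable lborel (\<lambda>\<xi>::'a. (\<integral>y. norm (f y) \<partial>lborel) * gauss (\<epsilon> *\<^sub>R \<xi>))"
        using scaled by (rule integrable_mult_right)
      then show "integrable lborel (\<lambda>\<xi>::'a. \<integral>y. norm (case (\<xi>, y) of (\<xi>, y) \<Rightarrow> f y * gauss (\<epsilon> *\<^sub>R \<xi>)) \<partial>lborel)"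
        by (simp add: norm_mult)
      show "AE \<xi>::'a in lborel. integrable lborel (\<lambda>y. case (\<xi>, y) of (\<xi>, y) \<Rightarrow> f y * gauss (\<epsilon> *\<^sub>R \<xi>))"
        using f by simp
    qed measurable
    then show "integrable (lborel \<Otimes>\<^sub>M lborel) (\<lambda>(\<xi>, y). ?g \<xi> y)"
      by (rule Bochner_Integration.integrable_bound) (auto simp: norm_mult)
  qed
  also have "\<dots> = (\<integral>y. inverse \<epsilon> ^ DIM('a) *\<^sub>R (f y * gauss (inverse \<epsilon> *\<^sub>R (y - x))) \<partial>lborel)"
    by (simp only: inner)
  also have "\<dots> = \<bar>\<epsilon>\<bar> ^ DIM('a) *\<^sub>R (\<integral>w. inverse \<epsilon> ^ DIM('a) *\<^sub>R (f (x + \<epsilon> *\<^sub>R w) * gauss (inverse \<epsilon> *\<^sub>R (x + \<epsilon> *\<^sub>R w - x))) \<partial>lborel)"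
    using \<epsilon> by (intro lborel_integral_affine) auto
  also have "\<dots> = (\<integral>w. f (x + \<epsilon> *\<^sub>R w) * gauss w \<partial>lborel)"
    using \<epsilon> by (simp flip: power_mult_distrib)
  finally show ?thesis .
qed

text \<open>
  Both sides of the damped formula converge as \<open>\<epsilon> \<rightarrow> 0\<close>: the
  left one is dominated by the integrable transform, the right one by the Gaussian times the
  bound for \<open>f\<close>.
\<close>
lemma fourier_inversion_integrable:
  fixes f :: "'a::euclidean_space \<Rightarrow> complex"
  assumes f: "integrable lborel f" and cont: "continuous_on UNIV f" and bdd: "\<And>x. norm (f x) \<le> B"
    and F: "integrable lborel (\<lambda>\<xi>. \<integral>y. f y * cis (2 * pi * (y \<bullet> \<xi>)) \<partial>lborel)"
  shows "(\<integral>\<xi>. (\<integral>y. f y * cis (2 * pi * (y \<bullet> \<xi>)) \<partial>lborel) * cis (- (2 * pi * (x \<bullet> \<xi>))) \<partial>lborel) = f x"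
proof -
  let ?F = "\<lambda>\<xi>. \<integral>y. f y * cis (2 * pi * (y \<bullet> \<xi>)) \<partial>lborel"
  let ?e = "\<lambda>n. inverse (real (Suc n))"
  have [measurable]: "f \<in> borel_measurable borel" using f by auto
  have [measurable]: "?F \<in> borel_measurable borel" using F by auto
  have e0: "?e \<longlonglongrightarrow> 0" by (rule LIMSEQ_inverse_real_of_nat)
  have "(\<lambda>n. \<integral>\<xi>. ?F \<xi> * cis (- (2 * pi * (x \<bullet> \<xi>))) * gauss (?e n *\<^sub>R \<xi>) \<partial>lborel)
      \<longlonglongrightarrow> (\<integral>\<xi>. ?F \<xi> * cis (- (2 * pi * (x \<bullet> \<xi>))) \<partial>lborel)"
  proof (rule integral_dominated_convergence[where w = "\<lambda>\<xi>. norm (?F \<xi>)"])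
    have "(\<lambda>n. complex_of_real (gauss (?e n *\<^sub>R \<xi>))) \<longlonglongrightarrow> of_real (gauss (0 *\<^sub>R \<xi>))" for \<xi> :: 'a
      unfolding gauss_def by (intro tendsto_intros e0)
    from tendsto_mult_left[OF this]
    show "AE \<xi> in lborel. (\<lambda>n. ?F \<xi> * cis (- (2 * pi * (x \<bullet> \<xi>))) * gauss (?e n *\<^sub>R \<xi>))
        \<longlonglongrightarrow> ?F \<xi> * cis (- (2 * pi * (x \<bullet> \<xi>)))"
      by (intro AE_I2) (simp add: gauss_def)
    show "AE \<xi> in lborel. norm (?F \<xi> * cis (- (2 * pi * (x \<bullet> \<xi>))) * gauss (?e n *\<^sub>R \<xi>)) \<le> norm (?F \<xi>)" for n
      by (intro AE_I2) (auto simp: norm_mult gauss_def intro!: mult_left_le)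
  qed (use F in auto)
  moreover have "(\<lambda>n. \<integral>w. f (x + ?e n *\<^sub>R w) * gauss w \<partial>lborel) \<longlonglongrightarrow> (\<integral>w. f x * gauss (w::'a) \<partial>lborel)"
  proof (rule integral_dominated_convergence[where w = "\<lambda>w::'a. B * gauss w"])
    have "(\<lambda>n. f (x + ?e n *\<^sub>R w)) \<longlonglongrightarrow> f x" for w
    proof -
      have "(\<lambda>n. x + ?e n *\<^sub>R w) \<longlonglongrightarrow> x + 0 *\<^sub>R w" by (intro tendsto_intros e0)
      from continuous_on_tendsto_compose[OF cont this] show ?thesis by simp
    qed
    then show "AE w in lborel. (\<lambda>n. f (x + ?e n *\<^sub>R w) * gauss w) \<longlonglongrightarrow> f x * gauss w"
      by (intro AE_I2 tendsto_intros)
    show "AE w in lborel. norm (f (x + ?e n *\<^sub>R w) * gauss w) \<le> B * gauss w" for n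
      by (intro AE_I2) (auto simp: norm_mult bdd intro!: mult_right_mono)
  qed (auto simp: integrable_gauss)
  moreover have "(\<integral>\<xi>. ?F \<xi> * cis (- (2 * pi * (x \<bullet> \<xi>))) * gauss (?e n *\<^sub>R \<xi>) \<partial>lborel)
      = (\<integral>w. f (x + ?e n *\<^sub>R w) * gauss w \<partial>lborel)" for n
    by (rule fourier_inversion_gauss[OF f]) simp
  ultimately have "(\<integral>\<xi>. ?F \<xi> * cis (- (2 * pi * (x \<bullet> \<xi>))) \<partial>lborel) = (\<integral>w. f x * gauss (w::'a) \<partial>lborel)"
    by (simp only: LIMSEQ_unique)
  also have "(\<integral>w. f x * gauss (w::'a) \<partial>lborel) = f x"
    by (simp add: integral_gauss)
  finally show ?thesis .
qed

section \<open>The Fourier transform on the Schwartz class\<close>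

text \<open>
  Compare with \<open>\<Prod> 1 / (1 + x\<^sub>b\<^sup>2)\<close>, which is integrable
  coordinate by coordinate.
\<close>
lemma integrable_inverse_polynomial:
  "integrable lborel (\<lambda>x::'a::euclidean_space. 1 / (1 + norm x) ^ (2 * DIM('a)))"
proof -
  have "integrable lborel (\<lambda>x::real. 1 / (1 + x\<^sup>2))"
    using integrable_inverse_1_plus_square by (simp add: set_integrable_def inverse_eq_divide einterval_def)
  then have "integrable lborel (\<lambda>x::'a. \<Prod>b\<in>Basis. 1 / (1 + (x \<bullet> b)\<^sup>2))"
    by (intro integrable_prod_coordinates)
  then show ?thesis
  proof (rule Bochner_Integration.integrable_bound)
    have "(\<Prod>b\<in>Basis. 1 + (x \<bullet> b)\<^sup>2) \<le> (\<Prod>b\<in>(Basis :: 'a set). (1 + norm x)\<^sup>2)" for x :: 'a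
    proof (intro prod_mono conjI)
      fix b :: 'a assume "b \<in> Basis"
      then have "\<bar>x \<bullet> b\<bar>\<^sup>2 \<le> (norm x)\<^sup>2" by (intro power_mono Basis_le_norm) auto
      then show "1 + (x \<bullet> b)\<^sup>2 \<le> (1 + norm x)\<^sup>2" by (simp add: power2_sum add_increasing2)
    qed auto
    moreover have "0 < (\<Prod>b\<in>Basis. 1 + (x \<bullet> b)\<^sup>2)" for x :: 'a
      by (intro prod_pos) (auto intro: add_pos_nonneg)
    ultimately have "1 / (1 + norm x) ^ (2 * DIM('a)) \<le> 1 / (\<Prod>b\<in>Basis. 1 + (x \<bullet> b)\<^sup>2)" for x :: 'a
      unfolding power_mult by (intro frac_le) simp_all
    then have le: "1 / (1 + norm x) ^ (2 * DIM('a)) \<le> (\<Prod>b\<in>Basis. 1 / (1 + (x \<bullet> b)\<^sup>2))" for x :: 'a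
      by (simp add: prod_dividef)
    have "norm (1 / (1 + norm x) ^ (2 * DIM('a))) \<le> norm (\<Prod>b\<in>Basis. 1 / (1 + (x \<bullet> b)\<^sup>2))" for x :: 'a
      using order_trans[OF le[of x] abs_ge_self] by simp
    then show "AE x in lborel. norm (1 / (1 + norm (x::'a)) ^ (2 * DIM('a))) \<le> norm (\<Prod>b\<in>Basis. 1 / (1 + (x \<bullet> b)\<^sup>2))"
      by (rule AE_I2)
  qed measurable
qed

lemma schwartz_continuous: "\<phi> \<in> schwartz \<Longrightarrow> continuous_on UNIV \<phi>"
  by (simp add: continuous_at_imp_continuous_on differentiable_imp_continuous_within schwartz_differentiable)

lemma schwartz_measurable: "\<phi> \<in> schwartz \<Longrightarrow> \<phi> \<in> borel_measurable borel"
  by (intro borel_measurable_continuous_onI schwartz_continuous)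

lemma schwartz_bounded: "\<phi> \<in> schwartz \<Longrightarrow> \<exists>B\<ge>0. \<forall>x. norm (\<phi> x) \<le> B"
  using schwartz_decay_shifted[of \<phi> 0] by simp

lemma schwartz_le_inverse_polynomial:
  fixes \<phi> :: "real^'n::finite \<Rightarrow> complex"
  assumes "\<phi> \<in> schwartz"
  shows "\<exists>B\<ge>0. \<forall>x. (1 + norm x) ^ k * norm (\<phi> x) \<le> B * (1 / (1 + norm x) ^ (2 * DIM(real^'n)))"
proof -
  obtain B where B: "B \<ge> 0" "\<And>x. (1 + norm x) ^ (2 * DIM(real^'n) + k) * norm (\<phi> x) \<le> B"
    using schwartz_decay_shifted[OF assms] by blast
  have "(1 + norm x) ^ (2 * DIM(real^'n)) > 0" for x :: "real^'n"
    by (intro zero_less_power) (smt (verit) norm_ge_zero)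
  then have "(1 + norm x) ^ k * norm (\<phi> x) \<le> B * (1 / (1 + norm x) ^ (2 * DIM(real^'n)))" for x
    using B(2)[of x] by (simp only: pos_le_divide_eq times_divide_eq_right mult_1_right power_add ac_simps)
  with B(1) show ?thesis by blast
qed

lemma schwartz_integrable_power:
  fixes \<phi> :: "real^'n::finite \<Rightarrow> complex"
  assumes "\<phi> \<in> schwartz"
  shows "integrable lborel (\<lambda>x. (1 + norm x) ^ k * norm (\<phi> x))"
proof -
  note [measurable] = schwartz_measurable[OF assms]
  obtain B where B: "B \<ge> 0" "\<And>x. (1 + norm x) ^ k * norm (\<phi> x) \<le> B * (1 / (1 + norm x) ^ (2 * DIM(real^'n)))"
    using schwartz_le_inverse_polynomial[OF assms] by blast
  show ?thesis
  proof (rule Bochner_Integration.integrable_bound)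
    show "integrable lborel (\<lambda>x::real^'n. B * (1 / (1 + norm x) ^ (2 * DIM(real^'n))))"
      by (intro integrable_mult_right integrable_inverse_polynomial)
    show "AE x in lborel. norm ((1 + norm x) ^ k * norm (\<phi> x)) \<le> norm (B * (1 / (1 + norm x) ^ (2 * DIM(real^'n))))"
      using B by (intro AE_I2) (smt (verit) real_norm_def norm_ge_zero zero_le_power mult_nonneg_nonneg)
  qed measurable
qed

lemma schwartz_integrable:
  assumes "\<phi> \<in> schwartz" shows "integrable lborel \<phi>"
  using schwartz_integrable_power[OF assms, of 0] schwartz_measurable[OF assms]
  by (simp add: integrable_norm_iff)

lemma fourier_cis: "fourier \<phi> \<xi> = (\<integral>x. \<phi> x * cis (- (2 * pi * (x \<bullet> \<xi>))) \<partial>lborel)"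
  by (simp add: fourier_def cis_conv_exp mult_ac)

lemma inverse_fourier_cis: "inverse_fourier \<phi> \<xi> = (\<integral>x. \<phi> x * cis (2 * pi * (x \<bullet> \<xi>)) \<partial>lborel)"
  by (simp add: inverse_fourier_def cis_conv_exp mult_ac inner_commute)

lemma norm_integral_mult_cis_le:
  assumes "integrable M f" "g \<in> borel_measurable M"
  shows "norm (\<integral>x. f x * cis (g x) \<partial>M) \<le> (\<integral>x. norm (f x) \<partial>M)"
  using integral_norm_bound[of M "\<lambda>x. f x * cis (g x)"] by (simp add: norm_mult)

lemma norm_cis_taylor: "norm (cis \<theta> - 1 - \<i> * \<theta>) \<le> \<theta>\<^sup>2 / 2"
  using iexp_approx1[of \<theta> 1] by (simp add: cis_conv_exp power2_eq_square algebra_simps)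

text \<open>
  Differentiation under the integral sign. The second-order Taylor bound for \<open>cis\<close>
  controls the remainder by the second moment of \<open>\<psi>\<close> times
  \<open>|h|\<^sup>2\<close>, which gives the total derivative at once.
\<close>
lemma fourier_has_derivative:
  fixes \<psi> :: "real^'n::finite \<Rightarrow> complex"
  assumes \<psi>: "\<psi> \<in> schwartz"
  shows "(fourier \<psi> has_derivative
    (\<lambda>h. \<Sum>j\<in>UNIV. (h $ j) *\<^sub>R fourier (\<lambda>x. - 2 * pi * \<i> * of_real (x $ j) * \<psi> x) \<xi>)) (at \<xi>)"
    (is "(_ has_derivative ?L) _")
proof -
  note [measurable] = schwartz_measurable[OF \<psi>]
  let ?K = "2 * pi\<^sup>2 * (\<integral>x. (1 + norm x)\<^sup>2 * norm (\<psi> x) \<partial>lborel)"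
  let ?e = "\<lambda>x. cis (- (2 * pi * (x \<bullet> \<xi>)))"
  have coord: "(\<lambda>x. - 2 * pi * \<i> * of_real (x $ j) * \<psi> x) \<in> schwartz" for j
    using schwartz_symbol_mult[OF symbols_cmult[OF symbols.coord] \<psi>, of "- 2 * pi * \<i>" j] by simp
  have int_coord: "integrable lborel (\<lambda>x. - 2 * pi * \<i> * of_real (x $ j) * \<psi> x * ?e x)" for j
    by (intro integrable_mult_cis schwartz_integrable coord) measurable
  have L: "?L h = (\<integral>x. \<psi> x * ?e x * (\<i> * of_real (- (2 * pi * (x \<bullet> h)))) \<partial>lborel)"
    and int_L: "integrable lborel (\<lambda>x. \<psi> x * ?e x * (\<i> * of_real (- (2 * pi * (x \<bullet> h)))))" for h
  proof -
    have eq: "\<psi> x * ?e x * (\<i> * of_real (- (2 * pi * (x \<bullet> h)))) =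
        (\<Sum>j\<in>UNIV. (h $ j) *\<^sub>R (- 2 * pi * \<i> * of_real (x $ j) * \<psi> x * ?e x))" for x
      by (simp add: inner_vec_def sum_distrib_left sum_distrib_right scaleR_conv_of_real
        sum_negf[symmetric] mult_ac)
    show "integrable lborel (\<lambda>x. \<psi> x * ?e x * (\<i> * of_real (- (2 * pi * (x \<bullet> h)))))"
      unfolding eq by (intro Bochner_Integration.integrable_sum integrable_scaleR_right int_coord)
    show "?L h = (\<integral>x. \<psi> x * ?e x * (\<i> * of_real (- (2 * pi * (x \<bullet> h)))) \<partial>lborel)"
      unfolding eq fourier_cis
      by (subst Bochner_Integration.integral_sum) (simp_all add: int_coord[simplified])
  qed
  have remainder: "norm (fourier \<psi> (\<xi> + h) - fourier \<psi> \<xi> - ?L h) \<le> ?K * (norm h)\<^sup>2" for h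
  proof -
    have int1: "integrable lborel (\<lambda>x. \<psi> x * cis (- (2 * pi * (x \<bullet> \<eta>))))" for \<eta>
      by (intro integrable_mult_cis schwartz_integrable \<psi>) measurable
    let ?r = "\<lambda>x. \<psi> x * ?e x * (cis (- (2 * pi * (x \<bullet> h))) - 1 - \<i> * of_real (- (2 * pi * (x \<bullet> h))))"
    have "?r x = \<psi> x * cis (- (2 * pi * (x \<bullet> (\<xi> + h)))) - \<psi> x * ?e x
        - \<psi> x * ?e x * (\<i> * of_real (- (2 * pi * (x \<bullet> h))))" for x
    proof -
      have "cis (- (2 * pi * (x \<bullet> (\<xi> + h)))) = ?e x * cis (- (2 * pi * (x \<bullet> h)))"
        by (simp add: cis_mult inner_add_right distrib_left)
      then show ?thesis by (simp only: right_diff_distrib mult_1_right mult.assoc)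
    qed
    then have "(\<integral>x. ?r x \<partial>lborel) = (\<integral>x. \<psi> x * cis (- (2 * pi * (x \<bullet> (\<xi> + h)))) \<partial>lborel) - (\<integral>x. \<psi> x * ?e x \<partial>lborel)
        - (\<integral>x. \<psi> x * ?e x * (\<i> * of_real (- (2 * pi * (x \<bullet> h)))) \<partial>lborel)"
      by (simp only: Bochner_Integration.integral_diff Bochner_Integration.integrable_diff int1 int_L)
    then have eq: "fourier \<psi> (\<xi> + h) - fourier \<psi> \<xi> - ?L h = (\<integral>x. ?r x \<partial>lborel)"
      by (simp only: L fourier_cis[of \<psi>])
    have le: "norm (?r x) \<le> 2 * pi\<^sup>2 * (norm h)\<^sup>2 * ((1 + norm x)\<^sup>2 * norm (\<psi> x))" for x
    proof -
      have "\<bar>x \<bullet> h\<bar> \<le> (1 + norm x) * norm h"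
        using Cauchy_Schwarz_ineq2[of x h] by (rule order_trans) (simp add: mult_right_mono)
      then have "(x \<bullet> h)\<^sup>2 \<le> ((1 + norm x) * norm h)\<^sup>2"
        by (metis abs_ge_zero power2_abs power_mono)
      then have "(- (2 * pi * (x \<bullet> h)))\<^sup>2 / 2 \<le> 2 * pi\<^sup>2 * ((1 + norm x)\<^sup>2 * (norm h)\<^sup>2)"
        by (simp add: power_mult_distrib)
      with norm_cis_taylor[of "- (2 * pi * (x \<bullet> h))"]
      have "norm (cis (- (2 * pi * (x \<bullet> h))) - 1 - \<i> * of_real (- (2 * pi * (x \<bullet> h)))) \<le> 2 * pi\<^sup>2 * ((1 + norm x)\<^sup>2 * (norm h)\<^sup>2)"
        by (rule order_trans)
      then have "norm (\<psi> x) * norm (cis (- (2 * pi * (x \<bullet> h))) - 1 - \<i> * of_real (- (2 * pi * (x \<bullet> h)))) \<le> norm (\<psi> x) * (2 * pi\<^sup>2 * ((1 + norm x)\<^sup>2 * (norm h)\<^sup>2))"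
        by (rule mult_left_mono) simp
      then show ?thesis by (simp add: norm_mult mult_ac)
    qed
    have int_r: "integrable lborel (\<lambda>x. 2 * pi\<^sup>2 * (norm h)\<^sup>2 * ((1 + norm x)\<^sup>2 * norm (\<psi> x)))"
      by (intro integrable_mult_right schwartz_integrable_power \<psi>)
    have "norm (\<integral>x. ?r x \<partial>lborel) \<le> (\<integral>x. 2 * pi\<^sup>2 * (norm h)\<^sup>2 * ((1 + norm x)\<^sup>2 * norm (\<psi> x)) \<partial>lborel)"
      by (intro Bochner_Integration.integral_norm_bound_integral int_r le
        Bochner_Integration.integrable_bound[OF int_r]) (use le in \<open>auto intro!: AE_I2 intro: order_trans\<close>)
    also have "\<dots> = ?K * (norm h)\<^sup>2" by simp
    finally show ?thesis unfolding eq .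
  qed
  show ?thesis unfolding has_derivative_iff_norm
  proof
    show "bounded_linear ?L"
      by (intro bounded_linear_sum bounded_linear_scaleR_const bounded_linear_vec_nth)
    show "((\<lambda>y. norm (fourier \<psi> y - fourier \<psi> \<xi> - ?L (y - \<xi>)) / norm (y - \<xi>)) \<longlongrightarrow> 0) (at \<xi>)"
    proof (rule Lim_null_comparison)
      show "\<forall>\<^sub>F y in at \<xi>. norm (norm (fourier \<psi> y - fourier \<psi> \<xi> - ?L (y - \<xi>)) / norm (y - \<xi>)) \<le> ?K * norm (y - \<xi>)"
        unfolding eventually_at_filter
      proof (intro always_eventually allI impI)
        fix y assume "y \<noteq> \<xi>"
        then show "norm (norm (fourier \<psi> y - fourier \<psi> \<xi> - ?L (y - \<xi>)) / norm (y - \<xi>)) \<le> ?K * norm (y - \<xi>)"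
          using remainder[of "y - \<xi>"] by (simp add: pos_divide_le_eq power2_eq_square mult.assoc)
      qed
      have "((\<lambda>y. ?K * norm (y - \<xi>)) \<longlongrightarrow> ?K * norm (\<xi> - \<xi>)) (at \<xi>)"
        by (intro tendsto_intros)
      then show "((\<lambda>y. ?K * norm (y - \<xi>)) \<longlongrightarrow> 0) (at \<xi>)" by simp
    qed
  qed
qed

lemma partial_deriv_fourier:
  assumes "\<psi> \<in> schwartz"
  shows "partial_deriv j (fourier \<psi>) \<xi> = fourier (\<lambda>x. - 2 * pi * \<i> * of_real (x $ j) * \<psi> x) \<xi>"
  by (subst partial_deriv_eq[OF fourier_has_derivative[OF assms]])
    (simp add: axis_def if_distrib[of "\<lambda>c. c *\<^sub>R _"] cong: if_cong)

lemma has_vector_derivative_imp_sequence: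
  fixes f :: "real \<Rightarrow> complex"
  assumes f: "(f has_vector_derivative d) (at 0)" and e: "e \<longlonglongrightarrow> 0" "\<And>n. e n \<noteq> 0"
  shows "(\<lambda>n. (f (e n) - f 0) / of_real (e n)) \<longlonglongrightarrow> d"
proof -
  have "((\<lambda>y. norm ((f y - f 0) - (y - 0) *\<^sub>R d) / norm (y - 0)) \<longlongrightarrow> 0) (at 0)"
    using f unfolding has_vector_derivative_def has_derivative_iff_norm by simp
  moreover have "filterlim e (at 0) sequentially"
    using e by (simp add: filterlim_at)
  ultimately have "(\<lambda>n. norm ((f (e n) - f 0) - (e n - 0) *\<^sub>R d) / norm (e n - 0)) \<longlonglongrightarrow> 0"
    by (rule filterlim_compose)
  moreover have "norm ((f (e n) - f 0) - (e n - 0) *\<^sub>R d) / norm (e n - 0) = norm ((f (e n) - f 0) / of_real (e n) - d)" for n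
  proof -
    have "(f (e n) - f 0) / of_real (e n) - d = ((f (e n) - f 0) - (e n - 0) *\<^sub>R d) / of_real (e n)"
      using e(2)[of n] by (simp add: scaleR_conv_of_real diff_divide_distrib)
    then show ?thesis by (simp only: norm_divide norm_of_real diff_0_right real_norm_def)
  qed
  ultimately have "(\<lambda>n. norm ((f (e n) - f 0) / of_real (e n) - d)) \<longlonglongrightarrow> 0"
    by (simp only:)
  then show ?thesis
    by (rule LIM_zero_cancel[OF tendsto_norm_zero_cancel])
qed

lemma schwartz_line_derivative:
  assumes "\<psi> \<in> schwartz"
  shows "((\<lambda>t. \<psi> (x + t *\<^sub>R axis j 1)) has_vector_derivative partial_deriv j \<psi> (x + t *\<^sub>R axis j 1)) (at t)"
proof -
  have D: "(\<psi> has_derivative frechet_derivative \<psi> (at y)) (at y)" for y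
    using schwartz_differentiable[OF assms] frechet_derivative_works by blast
  then have "linear (frechet_derivative \<psi> (at y))" for y
    using has_derivative_linear by blast
  note lin = linear_scale[OF this]
  have "((\<lambda>t. x + t *\<^sub>R axis j 1) has_derivative (\<lambda>h. h *\<^sub>R axis j 1)) (at t)"
    by (auto intro!: derivative_eq_intros)
  from has_derivative_compose[OF this D] show ?thesis
    by (simp add: has_vector_derivative_def lin partial_deriv_def)
qed

text \<open>
  An integrable majorant for the difference quotients of \<open>\<psi>\<close>, uniform in the
  step: the mean value inequality bounds them by values of \<open>partial_deriv j \<psi>\<close>
  at distance at most one, and moving by at most one changes \<open>1 + |x|\<close> by at most a
  factor of two.
\<close>
lemma schwartz_difference_quotient_bound:
  fixes \<psi> :: "real^'n::finite \<Rightarrow> complex" and j :: 'n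
  assumes \<psi>: "\<psi> \<in> schwartz"
  shows "\<exists>B\<ge>0. \<forall>x. \<forall>e\<in>{0<..1}. norm (\<psi> (x + e *\<^sub>R axis j 1) - \<psi> x) \<le>
    e * (B * (1 / (1 + norm x) ^ (2 * DIM(real^'n))))"
proof -
  let ?N = "2 * DIM(real^'n)"
  obtain B where B: "B \<ge> 0" "\<And>x. norm (partial_deriv j \<psi> x) \<le> B * (1 / (1 + norm x) ^ ?N)"
    using schwartz_le_inverse_polynomial[OF schwartz_partial_deriv[OF \<psi>], of 0 j] by auto
  have "norm (\<psi> (x + e *\<^sub>R axis j 1) - \<psi> x) \<le> e * ((2 ^ ?N * B) * (1 / (1 + norm x) ^ ?N))"
    if e: "e \<in> {0<..1}" for x e
  proof -
    define M where "M = (2 ^ ?N * B) * (1 / (1 + norm x) ^ ?N)"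
    have "norm (partial_deriv j \<psi> (x + t *\<^sub>R axis j 1)) \<le> M" if t: "t \<in> {0..e}" for t
    proof -
      let ?y = "x + t *\<^sub>R axis j 1"
      have "norm x \<le> norm ?y + norm (t *\<^sub>R axis j 1 :: real^'n)"
        by (metis add_diff_cancel_right' norm_triangle_ineq4)
      also have "\<dots> \<le> norm ?y + 1" using t e by (intro add_left_mono) (simp add: norm_axis_1)
      also have "\<dots> \<le> 2 * norm ?y + 1" by simp
      finally have "1 + norm x \<le> 2 * (1 + norm ?y)" by simp
      then have "(1 + norm x) ^ ?N \<le> (2 * (1 + norm ?y)) ^ ?N"
        by (rule power_mono) simp
      moreover have "0 < (1 + norm x) ^ ?N" "0 < (1 + norm ?y) ^ ?N"
        by (intro zero_less_power add_pos_nonneg zero_less_one norm_ge_zero)+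
      ultimately have "(1 / (1 + norm ?y) ^ ?N) \<le> 2 ^ ?N * (1 / (1 + norm x) ^ ?N)"
        unfolding power_mult_distrib
        by (simp only: times_divide_eq_right mult_1_right pos_divide_le_eq pos_le_divide_eq divide_divide_eq_left times_divide_eq_left mult_1_left)
      then have "B * (1 / (1 + norm ?y) ^ ?N) \<le> B * (2 ^ ?N * (1 / (1 + norm x) ^ ?N))"
        using B by (intro mult_left_mono)
      with B(2)[of ?y] show ?thesis by (simp add: M_def mult_ac)
    qed
    moreover have "continuous_on {0..e} (\<lambda>t. \<psi> (x + t *\<^sub>R axis j 1))"
      by (intro continuous_on_compose2[OF schwartz_continuous[OF \<psi>]] continuous_intros) auto
    ultimately have "norm (\<psi> (x + e *\<^sub>R axis j 1) - \<psi> (x + 0 *\<^sub>R axis j 1)) \<le> M * e - M * 0"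
      using e by (intro differentiable_bound_general[where \<phi>' = "\<lambda>_. M" and f' = "\<lambda>t. partial_deriv j \<psi> (x + t *\<^sub>R axis j 1)"]
        schwartz_line_derivative[OF \<psi>]) (auto intro!: derivative_eq_intros continuous_intros)
    then show ?thesis by (simp add: M_def mult_ac)
  qed
  with B(1) show ?thesis by (intro exI[of _ "2 ^ ?N * B"]) auto
qed

text \<open>
  Instead of integrating by parts in several variables, pass to the limit in difference
  quotients. A translation of \<open>\<psi>\<close> multiplies the transform by a character,
  whose difference quotient tends to \<open>2\<pi>i \<xi>\<^sub>j\<close>.
\<close>
lemma fourier_partial_deriv:
  fixes \<psi> :: "real^'n::finite \<Rightarrow> complex"
  assumes \<psi>: "\<psi> \<in> schwartz"
  shows "fourier (partial_deriv j \<psi>) \<xi> = 2 * pi * \<i> * of_real (\<xi> $ j) * fourier \<psi> \<xi>"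
proof -
  note [measurable] = schwartz_measurable[OF \<psi>] schwartz_measurable[OF schwartz_partial_deriv[OF \<psi>]]
  let ?h = "\<lambda>n. inverse (real (Suc n))"
  let ?e = "\<lambda>x. cis (- (2 * pi * (x \<bullet> \<xi>)))"
  let ?q = "\<lambda>n x. (\<psi> (x + ?h n *\<^sub>R axis j 1) - \<psi> x) / of_real (?h n)"
  let ?c = "2 * pi * \<xi> $ j"
  have h: "?h \<longlonglongrightarrow> 0" "?h n \<noteq> 0" "?h n \<in> {0<..1}" for n
    using LIMSEQ_inverse_real_of_nat by (auto simp: divide_simps)
  obtain B where B: "B \<ge> 0" "\<And>x e. e \<in> {0<..1} \<Longrightarrow> norm (\<psi> (x + e *\<^sub>R axis j 1) - \<psi> x) \<le>
      e * (B * (1 / (1 + norm x) ^ (2 * DIM(real^'n))))"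
    using schwartz_difference_quotient_bound[OF \<psi>] by metis
  have "(\<lambda>n. \<integral>x. ?q n x * ?e x \<partial>lborel) \<longlonglongrightarrow> (\<integral>x. partial_deriv j \<psi> x * ?e x \<partial>lborel)"
  proof (rule integral_dominated_convergence[where w = "\<lambda>x::real^'n. B * (1 / (1 + norm x) ^ (2 * DIM(real^'n)))"])
    show "integrable lborel (\<lambda>x::real^'n. B * (1 / (1 + norm x) ^ (2 * DIM(real^'n))))"
      by (intro integrable_mult_right integrable_inverse_polynomial)
    have "(\<lambda>n. ?q n x) \<longlonglongrightarrow> partial_deriv j \<psi> x" for x
      using has_vector_derivative_imp_sequence[OF schwartz_line_derivative[OF \<psi>, of x j 0] h(1,2)] by simp
    then show "AE x in lborel. (\<lambda>n. ?q n x * ?e x) \<longlonglongrightarrow> partial_deriv j \<psi> x * ?e x"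
      by (intro AE_I2 tendsto_mult_right)
    show "AE x in lborel. norm (?q n x * ?e x) \<le> B * (1 / (1 + norm x) ^ (2 * DIM(real^'n)))" for n
    proof (intro AE_I2)
      fix x :: "real^'n"
      have "norm (?q n x) \<le> B * (1 / (1 + norm x) ^ (2 * DIM(real^'n)))"
        unfolding norm_divide norm_of_real using B(2)[OF h(3)[of n], of x] h(3)[of n]
        by (subst pos_divide_le_eq) (auto simp: mult_ac)
      then show "norm (?q n x * ?e x) \<le> B * (1 / (1 + norm x) ^ (2 * DIM(real^'n)))"
        unfolding norm_mult by simp
    qed
  qed measurable
  moreover have "(\<integral>x. ?q n x * ?e x \<partial>lborel) = ((cis (?c * ?h n) - cis (?c * 0)) / of_real (?h n)) * fourier \<psi> \<xi>" for n
  proof -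
    have int: "integrable lborel (\<lambda>x. \<psi> x * ?e x)"
      by (intro integrable_mult_cis schwartz_integrable \<psi>) measurable
    have shift: "\<psi> (x + ?h n *\<^sub>R axis j 1) * ?e x = cis (?c * ?h n) * (\<lambda>y. \<psi> y * ?e y) (?h n *\<^sub>R axis j 1 + 1 *\<^sub>R x)" for x
    proof -
      have "(?h n *\<^sub>R axis j 1 + 1 *\<^sub>R x) \<bullet> \<xi> = ?h n * \<xi> $ j + x \<bullet> \<xi>"
        by (simp add: inner_add_left inner_axis')
      then have "?e x = cis (?c * ?h n) * ?e (?h n *\<^sub>R axis j 1 + 1 *\<^sub>R x)"
        by (simp only: cis_mult) (simp add: algebra_simps)
      then show ?thesis by (simp add: add.commute mult_ac)
    qed
    have int': "integrable lborel (\<lambda>x. cis (?c * ?h n) * (\<lambda>y. \<psi> y * ?e y) (?h n *\<^sub>R axis j 1 + 1 *\<^sub>R x))"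
      by (intro integrable_mult_right lborel_integrable_affine int) simp
    have "?q n x * ?e x = (1 / of_real (?h n)) * (\<psi> (x + ?h n *\<^sub>R axis j 1) * ?e x - \<psi> x * ?e x)" for x
      by (simp add: field_simps)
    then have "(\<integral>x. ?q n x * ?e x \<partial>lborel) = (1 / of_real (?h n)) *
        ((\<integral>x. cis (?c * ?h n) * (\<lambda>y. \<psi> y * ?e y) (?h n *\<^sub>R axis j 1 + 1 *\<^sub>R x) \<partial>lborel) - (\<integral>x. \<psi> x * ?e x \<partial>lborel))"
      unfolding shift by (simp only: integral_mult_right_zero Bochner_Integration.integral_diff[OF int' int])
    also have "(\<integral>x. cis (?c * ?h n) * (\<lambda>y. \<psi> y * ?e y) (?h n *\<^sub>R axis j 1 + 1 *\<^sub>R x) \<partial>lborel) = cis (?c * ?h n) * (\<integral>x. \<psi> x * ?e x \<partial>lborel)"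
      by (simp only: integral_mult_right_zero) (subst lborel_integral_affine[of "\<lambda>y. \<psi> y * ?e y" 1 "?h n *\<^sub>R axis j 1"], simp_all)
    finally show ?thesis by (simp add: fourier_cis field_simps)
  qed
  moreover have "(\<lambda>n. ((cis (?c * ?h n) - cis (?c * 0)) / of_real (?h n)) * fourier \<psi> \<xi>) \<longlonglongrightarrow> (?c * \<i>) * fourier \<psi> \<xi>"
  proof (intro tendsto_mult_right has_vector_derivative_imp_sequence[where f = "\<lambda>t. cis (?c * t)"] h(1,2))
    show "((\<lambda>t. cis (?c * t)) has_vector_derivative (?c * \<i>)) (at 0)"
      by (auto intro!: derivative_eq_intros simp: has_vector_derivative_def scaleR_conv_of_real mult_ac)
  qed
  ultimately have "(\<integral>x. partial_deriv j \<psi> x * ?e x \<partial>lborel) = (?c * \<i>) * fourier \<psi> \<xi>"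
    by (simp only: LIMSEQ_unique)
  then show ?thesis by (simp add: fourier_cis mult_ac)
qed

text \<open>
  Each factor \<open>|\<xi>| \<le> \<Sum>|\<xi>\<^sub>j|\<close> is traded for a partial
  derivative of \<open>\<psi>\<close>.
\<close>
lemma fourier_decay:
  fixes \<psi> :: "real^'n::finite \<Rightarrow> complex"
  assumes "\<psi> \<in> schwartz"
  shows "\<exists>B. \<forall>\<xi>. norm \<xi> ^ k * norm (fourier \<psi> \<xi>) \<le> B"
  using assms
proof (induction k arbitrary: \<psi>)
  case 0
  have "norm (fourier \<psi> \<xi>) \<le> (\<integral>x. norm (\<psi> x) \<partial>lborel)" for \<xi>
    unfolding fourier_cis by (rule norm_integral_mult_cis_le[OF schwartz_integrable[OF 0]]) measurable
  then show ?case by auto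
next
  case (Suc k)
  have "\<exists>B. \<forall>\<xi>. norm \<xi> ^ k * norm (fourier (partial_deriv j \<psi>) \<xi>) \<le> B" for j
    by (intro Suc.IH schwartz_partial_deriv Suc.prems)
  then obtain B where B: "\<And>j \<xi>. norm \<xi> ^ k * norm (fourier (partial_deriv j \<psi>) \<xi>) \<le> B j" by metis
  have "norm \<xi> ^ Suc k * norm (fourier \<psi> \<xi>) \<le> (\<Sum>j\<in>UNIV. B j)" for \<xi>
  proof -
    have "norm \<xi> ^ Suc k * norm (fourier \<psi> \<xi>) \<le> (\<Sum>j\<in>UNIV. \<bar>\<xi> $ j\<bar>) * (norm \<xi> ^ k * norm (fourier \<psi> \<xi>))"
      unfolding power_Suc mult.assoc by (intro mult_right_mono norm_le_l1_cart) auto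
    also have "\<dots> = (\<Sum>j\<in>UNIV. norm \<xi> ^ k * (\<bar>\<xi> $ j\<bar> * norm (fourier \<psi> \<xi>)))"
      by (simp add: sum_distrib_left sum_distrib_right mult_ac)
    also have "\<dots> \<le> (\<Sum>j\<in>UNIV. norm \<xi> ^ k * norm (fourier (partial_deriv j \<psi>) \<xi>))"
    proof (intro sum_mono mult_left_mono)
      fix j
      have "1 * (\<bar>\<xi> $ j\<bar> * norm (fourier \<psi> \<xi>)) \<le> (2 * pi) * (\<bar>\<xi> $ j\<bar> * norm (fourier \<psi> \<xi>))"
        using pi_gt3 by (intro mult_right_mono) auto
      then show "\<bar>\<xi> $ j\<bar> * norm (fourier \<psi> \<xi>) \<le> norm (fourier (partial_deriv j \<psi>) \<xi>)"
        by (simp add: fourier_partial_deriv[OF Suc.prems] norm_mult mult_ac)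
    qed auto
    also have "\<dots> \<le> (\<Sum>j\<in>UNIV. B j)" by (intro sum_mono B)
    finally show ?thesis .
  qed
  then show ?case by blast
qed

lemma schwartz_fourier:
  fixes \<psi> :: "real^'n::finite \<Rightarrow> complex"
  assumes "\<psi> \<in> schwartz" shows "fourier \<psi> \<in> schwartz"
proof (rule schwartz_coinduct[where X = "fourier ` schwartz"])
  show "g differentiable (at x)" if "g \<in> fourier ` schwartz" for g :: "real^'n \<Rightarrow> complex" and x
    using that fourier_has_derivative by (auto simp: differentiable_def)
  show "\<exists>B. \<forall>x. norm x ^ k * norm (g x) \<le> B" if "g \<in> fourier ` schwartz" for g :: "real^'n \<Rightarrow> complex" and k
    using that fourier_decay by auto
  show "partial_deriv j g \<in> fourier ` schwartz" if "g \<in> fourier ` schwartz" for g :: "real^'n \<Rightarrow> complex" and j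
  proof -
    obtain \<psi> where \<psi>: "\<psi> \<in> schwartz" "g = fourier \<psi>"
      using \<open>g \<in> fourier ` schwartz\<close> by blast
    have "(\<lambda>x. - 2 * pi * \<i> * of_real (x $ j) * \<psi> x) \<in> schwartz"
      using schwartz_symbol_mult[OF symbols_cmult[OF symbols.coord] \<psi>(1), of "- 2 * pi * \<i>" j] by simp
    moreover have "partial_deriv j g = fourier (\<lambda>x. - 2 * pi * \<i> * of_real (x $ j) * \<psi> x)"
      unfolding \<psi>(2) by (rule ext) (rule partial_deriv_fourier[OF \<psi>(1)])
    ultimately show ?thesis by blast
  qed
qed (use assms in auto)

lemma inverse_fourier_reflect: "inverse_fourier \<phi> \<xi> = fourier \<phi> (- \<xi>)"
  by (simp add: fourier_cis inverse_fourier_cis)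

lemma schwartz_inverse_fourier: "\<psi> \<in> schwartz \<Longrightarrow> inverse_fourier \<psi> \<in> schwartz"
  unfolding inverse_fourier_reflect[abs_def] by (intro schwartz_reflect schwartz_fourier)

lemma fourier_inverse_fourier:
  assumes "integrable lborel f" "continuous_on UNIV f" "\<And>x. norm (f x) \<le> B"
    and "integrable lborel (inverse_fourier f)"
  shows "fourier (inverse_fourier f) = f"
  using fourier_inversion_integrable[OF assms(1-3)] assms(4)
  unfolding fourier_cis[abs_def] inverse_fourier_cis[abs_def] by (simp add: inner_commute)

lemma fourier_inverse_fourier_schwartz: "\<phi> \<in> schwartz \<Longrightarrow> fourier (inverse_fourier \<phi>) = \<phi>"
  using schwartz_bounded[of \<phi>]
  by (meson fourier_inverse_fourier schwartz_integrable schwartz_continuous schwartz_inverse_fourier)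

lemma inverse_fourier_fourier_schwartz:
  fixes \<phi> :: "real^'n::finite \<Rightarrow> complex"
  assumes "\<phi> \<in> schwartz" shows "inverse_fourier (fourier \<phi>) = \<phi>"
proof
  fix x
  have [measurable]: "fourier \<phi> \<in> borel_measurable borel"
    by (intro schwartz_measurable schwartz_fourier assms)
  have "inverse_fourier (fourier \<phi>) x = (\<integral>\<xi>. fourier \<phi> (- \<xi>) * cis (2 * pi * (- \<xi> \<bullet> x)) \<partial>lborel)"
    unfolding inverse_fourier_cis by (subst lborel_integral_affine[where c = "-1" and t = 0]) simp_all
  also have "\<dots> = fourier (inverse_fourier \<phi>) x"
    by (simp add: fourier_cis[of "inverse_fourier \<phi>"] inverse_fourier_reflect)
  finally show "inverse_fourier (fourier \<phi>) x = \<phi> x"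
    by (simp add: fourier_inverse_fourier_schwartz[OF assms])
qed

section \<open>Convolution with finite measures on Lebesgue spaces\<close>

text \<open>
  The statement \<open>\<parallel>f\<parallel>\<^sub>p \<le> K\<close> without the root, so that
  it can be manipulated directly under the integral sign.
\<close>
definition Lp_bound :: "ennreal \<Rightarrow> (real^'n::finite \<Rightarrow> complex) \<Rightarrow> real \<Rightarrow> bool" where
  "Lp_bound p f K \<longleftrightarrow>
     (if p = top then AE x in lborel. norm (f x) \<le> K
      else (\<integral>\<^sup>+ x. ennreal (norm (f x) powr enn2real p) \<partial>lborel) \<le> ennreal (K powr enn2real p))"

lemma Lp_bound_top: "Lp_bound top f K \<longleftrightarrow> (AE x in lborel. norm (f x) \<le> K)"
  by (simp add: Lp_bound_def)

lemma Lp_bound_finite: "p \<noteq> top \<Longrightarrow> Lp_bound p f K \<longleftrightarrow>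
    (\<integral>\<^sup>+ x. ennreal (norm (f x) powr enn2real p) \<partial>lborel) \<le> ennreal (K powr enn2real p)"
  by (simp add: Lp_bound_def)

lemma enn2real_ge_1: "1 \<le> p \<Longrightarrow> p \<noteq> top \<Longrightarrow> 1 \<le> enn2real p"
  by (cases p) auto

lemma Lp_norm_le_iff_Lp_bound:
  assumes [measurable]: "f \<in> borel_measurable lborel" and p: "1 \<le> p" and K: "0 \<le> K"
  shows "Lp_norm p f \<le> ennreal K \<longleftrightarrow> Lp_bound p f K"
proof (cases "p = top")
  case True
  have "AE x in lborel. ennreal (norm (f x)) \<le> esssup lborel (\<lambda>x. ennreal (norm (f x)))"
    by (rule esssup_AE)
  then have "esssup lborel (\<lambda>x. ennreal (norm (f x))) \<le> ennreal K \<longleftrightarrow> (AE x in lborel. ennreal (norm (f x)) \<le> ennreal K)"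
    by (intro iffI esssup_I) (auto elim!: eventually_mono intro: order_trans)
  then show ?thesis
    using True K by (simp add: Lp_norm_def Lp_bound_top)
next
  case False
  define r where "r = enn2real p"
  define I where "I = (\<integral>\<^sup>+ x. ennreal (norm (f x) powr r) \<partial>lborel)"
  have r: "r \<ge> 1" using enn2real_ge_1[OF p False] by (simp add: r_def)
  have eq: "Lp_norm p f = (if I = top then top else ennreal (enn2real I powr (1 / r)))"
    using False by (simp add: Lp_norm_def Let_def I_def r_def)
  show ?thesis
  proof (cases I)
    case (real i)
    have "i powr (1 / r) \<le> K \<longleftrightarrow> i \<le> K powr r"
    proof
      assume "i powr (1 / r) \<le> K"
      then have "(i powr (1 / r)) powr r \<le> K powr r" using r by (intro powr_mono2) auto
      then show "i \<le> K powr r" using r real by (simp add: powr_powr)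
    next
      assume "i \<le> K powr r"
      then have "i powr (1 / r) \<le> (K powr r) powr (1 / r)" using r real by (intro powr_mono2) auto
      then show "i powr (1 / r) \<le> K" using r K by (simp add: powr_powr)
    qed
    then show ?thesis
      using real K False by (simp add: eq Lp_bound_finite flip: r_def I_def)
  next
    case top
    then show ?thesis
      using False by (simp add: eq Lp_bound_finite top_unique flip: r_def I_def)
  qed
qed

text \<open>
  For finite \<open>p\<close> this uses \<open>|f| \<le> 1 + |f|\<^sup>p\<close> in place of
  Hoelder's inequality. Uniformity in \<open>z\<close> is what allows integration over
  \<open>z\<close> against a finite measure.
\<close>
lemma Lp_pairing_bound:
  fixes f \<phi> :: "real^'n::finite \<Rightarrow> complex"
  assumes [measurable]: "f \<in> borel_measurable borel" and p: "1 \<le> p" and f: "Lp_bound p f K" and \<phi>: "\<phi> \<in> schwartz"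
  shows "\<exists>D<top. \<forall>z. (\<integral>\<^sup>+x. ennreal (norm (f x * \<phi> (x - z))) \<partial>lborel) \<le> D"
proof -
  note [measurable] = schwartz_measurable[OF \<phi>]
  obtain B where B: "B \<ge> 0" "\<And>x. norm (\<phi> x) \<le> B" using schwartz_bounded[OF \<phi>] by blast
  let ?S = "\<integral>\<^sup>+x. ennreal (norm (\<phi> x)) \<partial>lborel"
  have S: "?S < top" using schwartz_integrable[OF \<phi>] by (simp add: integrable_iff_bounded)
  have shift: "(\<integral>\<^sup>+x. ennreal (norm (\<phi> (x - z))) \<partial>lborel) = ?S" for z
    using lborel_nn_integral_affine[of "\<lambda>x. ennreal (norm (\<phi> x))" 1 "- z"] by simp
  show ?thesis
  proof (cases "p = top")
    case True
    have "(\<integral>\<^sup>+x. ennreal (norm (f x * \<phi> (x - z))) \<partial>lborel) \<le> ennreal K * ?S" for z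
    proof -
      have "AE x in lborel. ennreal (norm (f x * \<phi> (x - z))) \<le> ennreal K * ennreal (norm (\<phi> (x - z)))"
        using f unfolding True Lp_bound_top
        by eventually_elim (auto simp: norm_mult ennreal_mult' intro!: mult_right_mono ennreal_leI)
      then have "(\<integral>\<^sup>+x. ennreal (norm (f x * \<phi> (x - z))) \<partial>lborel) \<le> (\<integral>\<^sup>+x. ennreal K * ennreal (norm (\<phi> (x - z))) \<partial>lborel)"
        by (rule nn_integral_mono_AE)
      also have "\<dots> = ennreal K * ?S" by (simp add: nn_integral_cmult shift)
      finally show ?thesis .
    qed
    moreover have "ennreal K * ?S < top" using S by (simp add: ennreal_mult_less_top)
    ultimately show ?thesis by blast
  next
    case False
    define r where "r = enn2real p"
    define I where "I = (\<integral>\<^sup>+ x. ennreal (norm (f x) powr r) \<partial>lborel)"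
    have r: "r \<ge> 1" using enn2real_ge_1[OF p False] by (simp add: r_def)
    have I: "I < top"
      using f False by (simp add: Lp_bound_finite order_le_less_trans[OF _ ennreal_less_top] flip: r_def I_def)
    have "(\<integral>\<^sup>+x. ennreal (norm (f x * \<phi> (x - z))) \<partial>lborel) \<le> ?S + ennreal B * I" for z
    proof -
      have le: "ennreal (norm (f x * \<phi> (x - z))) \<le> ennreal (norm (\<phi> (x - z))) + ennreal B * ennreal (norm (f x) powr r)" for x
      proof -
        have "norm (f x) \<le> 1 + norm (f x) powr r"
        proof (cases "norm (f x) \<le> 1")
          case True
          then show ?thesis by (smt (verit) powr_ge_zero)
        next
          case False
          then show ?thesis using powr_mono[of 1 r "norm (f x)"] r by simp
        qed
        then have "norm (f x) * norm (\<phi> (x - z)) \<le> (1 + norm (f x) powr r) * norm (\<phi> (x - z))"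
          by (rule mult_right_mono) simp
        also have "\<dots> \<le> norm (\<phi> (x - z)) + B * norm (f x) powr r"
          using mult_left_mono[OF B(2)[of "x - z"], of "norm (f x) powr r"] by (simp add: algebra_simps)
        finally show ?thesis
          using B(1) by (simp add: norm_mult flip: ennreal_mult ennreal_plus)
      qed
      have "(\<integral>\<^sup>+x. ennreal (norm (f x * \<phi> (x - z))) \<partial>lborel) \<le>
          (\<integral>\<^sup>+x. ennreal (norm (\<phi> (x - z))) + ennreal B * ennreal (norm (f x) powr r) \<partial>lborel)"
        by (intro nn_integral_mono le)
      also have "\<dots> = ?S + ennreal B * I"
        by (simp add: nn_integral_add nn_integral_cmult shift I_def)
      finally show ?thesis .
    qed
    moreover have "?S + ennreal B * I < top" using S I by (simp add: ennreal_mult_less_top)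
    ultimately show ?thesis by blast
  qed
qed

lemma Lp_schwartz_integrable:
  fixes f \<phi> :: "real^'n::finite \<Rightarrow> complex"
  assumes [measurable]: "f \<in> borel_measurable borel" and p: "1 \<le> p" and f: "Lp_bound p f K" and \<phi>: "\<phi> \<in> schwartz"
  shows "integrable lborel (\<lambda>x. f x * \<phi> x)"
proof -
  note [measurable] = schwartz_measurable[OF \<phi>]
  obtain D where "D < top" "(\<integral>\<^sup>+x. ennreal (norm (f x * \<phi> (x - 0))) \<partial>lborel) \<le> D"
    using Lp_pairing_bound[OF assms] by blast
  then show ?thesis
    by (intro integrableI_bounded) (auto intro: order_le_less_trans)
qed

lemma ennreal_norm_integral_le: "ennreal (norm (\<integral>x. h x \<partial>M)) \<le> (\<integral>\<^sup>+x. ennreal (norm (h x)) \<partial>M)"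
  by (cases "integrable M h") (auto simp: integral_norm_bound_ennreal not_integrable_integral_eq)

text \<open>
  A convex power lies above its tangent at \<open>a\<close>.
\<close>
lemma tangent_le_powr:
  fixes x a r :: real
  assumes "0 \<le> x" "0 < a" "1 \<le> r"
  shows "r * a powr (r - 1) * x \<le> x powr r + (r - 1) * a powr r"
proof (cases "x = 0")
  case True
  then show ?thesis using assms by simp
next
  case False
  define u where "u = x / a"
  have u: "u > 0" using assms False by (simp add: u_def)
  have "(u powr r) powr (1 / r) * 1 powr (1 - 1 / r) \<le> (1 / r) * (u powr r) + (1 - 1 / r) * 1"
    using u assms by (intro Youngs_inequality_0) (auto simp: field_simps)
  then have "u \<le> (1 / r) * (u powr r) + (1 - 1 / r)"
    using u assms by (simp add: powr_powr)
  then have "r * u \<le> r * ((1 / r) * (u powr r) + (1 - 1 / r))"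
    using assms by (intro mult_left_mono) auto
  also have "\<dots> = u powr r + (r - 1)"
    using assms by (simp add: field_simps)
  finally have "r * u \<le> u powr r + (r - 1)" .
  then have "a powr r * (r * u) \<le> a powr r * (u powr r + (r - 1))"
    by (rule mult_left_mono) simp
  moreover have "a powr r * u powr r = x powr r" "a powr r * u = a powr (r - 1) * x"
    using assms u by (simp_all add: u_def powr_mult[symmetric] powr_diff)
  ultimately show ?thesis
    by (simp add: algebra_simps)
qed

text \<open>
  Jensen's inequality for a measure of mass at most \<open>c\<close>, in a form that makes sense
  for functions that need not be integrable. It is the tangent inequality at the mean value
  \<open>a = I / c\<close>, integrated.
\<close>
lemma powr_integral_le:
  fixes h :: "'a \<Rightarrow> complex"
  assumes "finite_measure M" and [measurable]: "h \<in> borel_measurable M"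
    and c: "0 < c" "measure M (space M) \<le> c" and r: "1 \<le> r"
  shows "ennreal (norm (\<integral>x. h x \<partial>M) powr r) \<le> ennreal (c powr (r - 1)) * (\<integral>\<^sup>+x. ennreal (norm (h x) powr r) \<partial>M)"
proof -
  interpret finite_measure M by fact
  consider "\<not> integrable M h" | "integrable M h" "(\<integral>\<^sup>+x. ennreal (norm (h x) powr r) \<partial>M) = top"
    | "integrable M h" "(\<integral>\<^sup>+x. ennreal (norm (h x) powr r) \<partial>M) < top"
    using top.not_eq_extremum by blast
  then show ?thesis
  proof cases
    case 1
    then show ?thesis by (simp add: not_integrable_integral_eq)
  next
    case 2
    then show ?thesis using c by (simp add: ennreal_mult_top)
  next
    case 3
    define A where "A = (\<integral>x. norm (h x) powr r \<partial>M)"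
    define I where "I = (\<integral>x. norm (h x) \<partial>M)"
    have int: "integrable M (\<lambda>x. norm (h x) powr r)"
      using 3 by (intro integrableI_bounded) auto
    have A: "(\<integral>\<^sup>+x. ennreal (norm (h x) powr r) \<partial>M) = ennreal A" "A \<ge> 0"
      unfolding A_def by (auto intro!: nn_integral_eq_integral int)
    have I0: "I \<ge> 0" unfolding I_def by simp
    have "I powr r \<le> c powr (r - 1) * A"
    proof (cases "I = 0")
      case True
      then show ?thesis using A c r by simp
    next
      case False
      \<comment> \<open>The mean of \<open>|h|\<close> if \<open>M\<close> had mass exactly \<open>c\<close>.\<close>
      define a where "a = I / c"
      have a: "a > 0" using False I0 c by (simp add: a_def)
      have "(\<integral>x. r * a powr (r - 1) * norm (h x) \<partial>M) \<le> (\<integral>x. norm (h x) powr r + (r - 1) * a powr r \<partial>M)"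
        using 3 int a r by (intro integral_mono tangent_le_powr) auto
      also have "\<dots> = A + (r - 1) * a powr r * measure M (space M)"
        using int by (simp add: A_def)
      also have "\<dots> \<le> A + (r - 1) * a powr r * c"
        using c r by (intro add_left_mono mult_left_mono) auto
      finally have "r * a powr (r - 1) * I \<le> A + (r - 1) * a powr r * c"
        by (simp add: I_def)
      moreover have "a powr (r - 1) * I = a powr r * c"
        using a c False I0 by (simp add: a_def powr_diff)
      ultimately have "r * (a powr r * c) \<le> A + (r - 1) * (a powr r * c)"
        by (simp only: mult.assoc)
      then have le: "a powr r * c \<le> A"
        by (simp add: left_diff_distrib)
      have "I powr r = c powr (r - 1) * (a powr r * c)"
        using c I0 by (simp add: a_def powr_divide powr_diff)
      also have "\<dots> \<le> c powr (r - 1) * A" using le by (intro mult_left_mono) auto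
      finally show ?thesis .
    qed
    moreover have "norm (\<integral>x. h x \<partial>M) powr r \<le> I powr r"
      unfolding I_def using r by (intro powr_mono2 integral_norm_bound) auto
    ultimately have "ennreal (norm (\<integral>x. h x \<partial>M) powr r) \<le> ennreal (c powr (r - 1) * A)"
      by (intro ennreal_leI) simp
    then show ?thesis using A by (simp add: ennreal_mult)
  qed
qed

locale finite_borel_measure = finite_measure M for M :: "(real^'n::finite) measure" +
  assumes sets_M [measurable_cong]: "sets M = sets borel"
begin

sublocale pair: pair_sigma_finite M lborel ..
sublocale pair': pair_sigma_finite lborel M ..

text \<open>
  Young's inequality for a convolution with a finite measure. For finite \<open>p\<close> the
  powers \<open>c\<^bsup>p-1\<^esup>\<close> from Jensen's inequality and \<open>c\<close> from
  the outer integration combine to \<open>c\<^sup>p\<close>; for \<open>p = \<infinity>\<close>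
  the translates of the null set where \<open>f\<close> exceeds its bound are null, and Fubini
  exchanges almost every \<open>x\<close> with almost every \<open>z\<close>.
\<close>
lemma Lp_bound_convolution:
  fixes f :: "real^'n \<Rightarrow> complex"
  assumes [measurable]: "f \<in> borel_measurable borel" and p: "1 \<le> p" and f: "Lp_bound p f K"
    and c: "0 < c" "measure M (space M) \<le> c" and K: "K \<ge> 0"
  shows "Lp_bound p (\<lambda>x. \<integral>z. f (x + z) \<partial>M) (c * K)"
proof (cases "p = top")
  case True
  have "AE x in lborel. norm (f (z + 1 *\<^sub>R x)) \<le> K" for z
    using f unfolding True Lp_bound_top
    by (subst (asm) lborel_affine[of 1 z]) (simp_all add: AE_density AE_distr_iff)
  then have "AE z in M. AE x in lborel. norm (f (x + z)) \<le> K"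
    by (simp add: add.commute)
  moreover have "{x \<in> space (lborel \<Otimes>\<^sub>M M). norm (f (fst x + snd x)) \<le> K} \<in> sets (lborel \<Otimes>\<^sub>M M)"
    by measurable
  ultimately have "AE x in lborel. AE z in M. norm (f (x + z)) \<le> K"
    by (subst pair'.AE_commute)
  then show ?thesis unfolding True Lp_bound_top
  proof eventually_elim
    case (elim x)
    have "ennreal (norm (\<integral>z. f (x + z) \<partial>M)) \<le> (\<integral>\<^sup>+z. ennreal (norm (f (x + z))) \<partial>M)"
      by (rule ennreal_norm_integral_le)
    also have "\<dots> \<le> (\<integral>\<^sup>+z. ennreal K \<partial>M)"
      using elim by (intro nn_integral_mono_AE) (auto elim!: eventually_mono intro!: ennreal_leI)
    also have "\<dots> = ennreal (K * measure M (space M))"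
      using K by (simp add: emeasure_eq_measure ennreal_mult)
    also have "\<dots> \<le> ennreal (c * K)"
      using mult_left_mono[OF c(2) K] by (intro ennreal_leI) (simp add: mult.commute)
    finally show ?case using K c by simp
  qed
next
  case False
  define r where "r = enn2real p"
  have r: "r \<ge> 1" using enn2real_ge_1[OF p False] by (simp add: r_def)
  have "(\<integral>\<^sup>+x. ennreal (norm (\<integral>z. f (x + z) \<partial>M) powr r) \<partial>lborel) \<le>
      (\<integral>\<^sup>+x. ennreal (c powr (r - 1)) * (\<integral>\<^sup>+z. ennreal (norm (f (x + z)) powr r) \<partial>M) \<partial>lborel)"
    by (intro nn_integral_mono powr_integral_le c r) (auto intro: finite_measure_axioms)
  also have "\<dots> = ennreal (c powr (r - 1)) * (\<integral>\<^sup>+x. (\<integral>\<^sup>+z. ennreal (norm (f (x + z)) powr r) \<partial>M) \<partial>lborel)"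
    by (rule nn_integral_cmult) measurable
  also have "(\<integral>\<^sup>+x. (\<integral>\<^sup>+z. ennreal (norm (f (x + z)) powr r) \<partial>M) \<partial>lborel) =
      (\<integral>\<^sup>+z. (\<integral>\<^sup>+x. ennreal (norm (f (x + z)) powr r) \<partial>lborel) \<partial>M)"
    by (rule pair.Fubini') measurable
  also have "(\<lambda>z. \<integral>\<^sup>+x. ennreal (norm (f (x + z)) powr r) \<partial>lborel) = (\<lambda>z. \<integral>\<^sup>+x. ennreal (norm (f x) powr r) \<partial>lborel)"
    using lborel_nn_integral_affine[of "\<lambda>x. ennreal (norm (f x) powr r)" 1] by (simp add: add.commute)
  also have "(\<integral>\<^sup>+z. (\<integral>\<^sup>+x. ennreal (norm (f x) powr r) \<partial>lborel) \<partial>M) \<le> ennreal (K powr r) * ennreal c"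
    using f False c by (simp add: Lp_bound_finite r_def emeasure_eq_measure mult_mono ennreal_leI)
  also have "ennreal (c powr (r - 1)) * (ennreal (K powr r) * ennreal c) = ennreal ((c * K) powr r)"
    using c K by (simp add: powr_mult powr_diff flip: ennreal_mult)
  finally show ?thesis
    using False by (simp add: Lp_bound_finite mult_left_mono flip: r_def)
qed

end

section \<open>Fourier multipliers of Lebesgue spaces\<close>

context finite_borel_measure
begin

lemma Lp_convolution_integrable:
  fixes f \<phi> :: "real^'n \<Rightarrow> complex"
  assumes [measurable]: "f \<in> borel_measurable borel" and p: "1 \<le> p" and f: "Lp_bound p f K" and \<phi>: "\<phi> \<in> schwartz"
  shows "integrable (M \<Otimes>\<^sub>M lborel) (\<lambda>(z, x). f x * \<phi> (x - z))"
    and "integrable (M \<Otimes>\<^sub>M lborel) (\<lambda>(z, y). f (y + z) * \<phi> y)"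
proof -
  note [measurable] = schwartz_measurable[OF \<phi>]
  obtain D where D: "D < top" "\<And>z. (\<integral>\<^sup>+x. ennreal (norm (f x * \<phi> (x - z))) \<partial>lborel) \<le> D"
    using Lp_pairing_bound[OF assms] by blast
  have "(\<integral>\<^sup>+z. D \<partial>M) < top"
    using D(1) by (simp add: ennreal_mult_less_top emeasure_eq_measure)
  then have 1: "(\<integral>\<^sup>+z. (\<integral>\<^sup>+x. ennreal (norm (f x * \<phi> (x - z))) \<partial>lborel) \<partial>M) < top"
    by (rule order_le_less_trans[rotated]) (intro nn_integral_mono D)
  then show "integrable (M \<Otimes>\<^sub>M lborel) (\<lambda>(z, x). f x * \<phi> (x - z))"
    by (intro integrableI_bounded) (simp_all add: lborel.nn_integral_fst[symmetric])
  have "(\<integral>\<^sup>+x. ennreal (norm (f x * \<phi> (x - z))) \<partial>lborel) = (\<integral>\<^sup>+y. ennreal (norm (f (y + z) * \<phi> y)) \<partial>lborel)" for z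
    using lborel_nn_integral_affine[of "\<lambda>x. ennreal (norm (f x * \<phi> (x - z)))" 1 z] by (simp add: add.commute)
  with 1 show "integrable (M \<Otimes>\<^sub>M lborel) (\<lambda>(z, y). f (y + z) * \<phi> y)"
    by (intro integrableI_bounded) (simp_all add: lborel.nn_integral_fst[symmetric])
qed

text \<open>
  The transpose of convolution by \<open>M\<close> is convolution by the reflection of
  \<open>M\<close>.
\<close>
lemma Lp_convolution_duality:
  fixes f \<phi> :: "real^'n \<Rightarrow> complex"
  assumes [measurable]: "f \<in> borel_measurable borel" and p: "1 \<le> p" and f: "Lp_bound p f K" and \<phi>: "\<phi> \<in> schwartz"
  shows "(\<integral>x. f x * (\<integral>z. \<phi> (x - z) \<partial>M) \<partial>lborel) = (\<integral>y. (\<integral>z. f (y + z) \<partial>M) * \<phi> y \<partial>lborel)"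
proof -
  note [measurable] = schwartz_measurable[OF \<phi>]
  have "(\<integral>x. f x * (\<integral>z. \<phi> (x - z) \<partial>M) \<partial>lborel) = (\<integral>x. (\<integral>z. f x * \<phi> (x - z) \<partial>M) \<partial>lborel)"
    by simp
  also have "\<dots> = (\<integral>z. (\<integral>x. f x * \<phi> (x - z) \<partial>lborel) \<partial>M)"
    by (rule pair.Fubini_integral[OF Lp_convolution_integrable(1)[OF assms]])
  also have "(\<lambda>z. \<integral>x. f x * \<phi> (x - z) \<partial>lborel) = (\<lambda>z. \<integral>y. f (y + z) * \<phi> y \<partial>lborel)"
  proof
    show "(\<integral>x. f x * \<phi> (x - z) \<partial>lborel) = (\<integral>y. f (y + z) * \<phi> y \<partial>lborel)" for z
      using lborel_integral_affine[of "\<lambda>x. f x * \<phi> (x - z)" 1 z] by (simp add: add.commute)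
  qed
  also have "(\<integral>z. (\<integral>y. f (y + z) * \<phi> y \<partial>lborel) \<partial>M) = (\<integral>y. (\<integral>z. f (y + z) * \<phi> y \<partial>M) \<partial>lborel)"
    by (rule pair.Fubini_integral[OF Lp_convolution_integrable(2)[OF assms], symmetric])
  finally show ?thesis by simp
qed

text \<open>
  The convolution on the right has the expected inverse transform by Fubini. It is not visibly a
  Schwartz function, since \<open>M\<close> may lack moments, but it is integrable, bounded and
  continuous, so the inversion formula identifies it.
\<close>
lemma fourier_multiplier_convolution:
  fixes \<phi> :: "real^'n \<Rightarrow> complex"
  assumes \<phi>: "\<phi> \<in> schwartz" and m: "m \<in> symbols" and M: "\<And>\<xi>. m \<xi> = (\<integral>z. cis (2 * pi * (z \<bullet> \<xi>)) \<partial>M)"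
  shows "fourier (\<lambda>\<xi>. m \<xi> * inverse_fourier \<phi> \<xi>) = (\<lambda>x. \<integral>z. \<phi> (x - z) \<partial>M)"
proof -
  note [measurable] = schwartz_measurable[OF \<phi>]
  let ?g = "\<lambda>x. \<integral>z. \<phi> (x - z) \<partial>M"
  have one: "Lp_bound top (\<lambda>_::real^'n. 1) 1" by (simp add: Lp_bound_top)
  have int: "integrable (M \<Otimes>\<^sub>M lborel) (\<lambda>(z, x). \<phi> (x - z))"
    using Lp_convolution_integrable(1)[OF _ _ one \<phi>] by simp
  obtain B where B: "B \<ge> 0" "\<And>x. norm (\<phi> x) \<le> B" using schwartz_bounded[OF \<phi>] by blast
  have "inverse_fourier ?g \<xi> = m \<xi> * inverse_fourier \<phi> \<xi>" for \<xi>
  proof -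
    have "inverse_fourier ?g \<xi> = (\<integral>x. (\<integral>z. \<phi> (x - z) * cis (2 * pi * (x \<bullet> \<xi>)) \<partial>M) \<partial>lborel)"
      by (simp add: inverse_fourier_cis)
    also have "\<dots> = (\<integral>z. (\<integral>x. \<phi> (x - z) * cis (2 * pi * (x \<bullet> \<xi>)) \<partial>lborel) \<partial>M)"
    proof (rule pair.Fubini_integral)
      show "integrable (M \<Otimes>\<^sub>M lborel) (\<lambda>(z, x). \<phi> (x - z) * cis (2 * pi * (x \<bullet> \<xi>)))"
        by (rule Bochner_Integration.integrable_bound[OF int]) (auto simp: norm_mult)
    qed
    also have "(\<lambda>z. \<integral>x. \<phi> (x - z) * cis (2 * pi * (x \<bullet> \<xi>)) \<partial>lborel) = (\<lambda>z. cis (2 * pi * (z \<bullet> \<xi>)) * inverse_fourier \<phi> \<xi>)"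
    proof
      fix z
      have "(\<integral>x. \<phi> (x - z) * cis (2 * pi * (x \<bullet> \<xi>)) \<partial>lborel) = (\<integral>y. \<phi> y * cis (2 * pi * ((z + y) \<bullet> \<xi>)) \<partial>lborel)"
        using lborel_integral_affine[of "\<lambda>x. \<phi> (x - z) * cis (2 * pi * (x \<bullet> \<xi>))" 1 z] by simp
      also have "\<dots> = (\<integral>y. cis (2 * pi * (z \<bullet> \<xi>)) * (\<phi> y * cis (2 * pi * (y \<bullet> \<xi>))) \<partial>lborel)"
        by (intro Bochner_Integration.integral_cong refl)
          (simp add: inner_add_left distrib_left cis_mult[symmetric])
      finally show "(\<integral>x. \<phi> (x - z) * cis (2 * pi * (x \<bullet> \<xi>)) \<partial>lborel) = cis (2 * pi * (z \<bullet> \<xi>)) * inverse_fourier \<phi> \<xi>"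
        by (simp add: inverse_fourier_cis)
    qed
    finally show ?thesis by (simp add: M)
  qed
  then have inv: "inverse_fourier ?g = (\<lambda>\<xi>. m \<xi> * inverse_fourier \<phi> \<xi>)" by blast
  have "fourier (inverse_fourier ?g) = ?g"
  proof (rule fourier_inverse_fourier)
    show "integrable lborel ?g"
      using pair'.integrable_fst'[OF pair.integrable_product_swap[OF int]] by simp
    show "integrable lborel (inverse_fourier ?g)"
      unfolding inv by (intro schwartz_integrable schwartz_symbol_mult m schwartz_inverse_fourier \<phi>)
    show "norm (?g x) \<le> B * measure M (space M)" for x
    proof -
      have int1: "integrable M (\<lambda>z. \<phi> (x - z))"
        by (rule integrable_const_bound[where B = B]) (auto simp: B)
      have "norm (?g x) \<le> (\<integral>z. B \<partial>M)"
        by (rule Bochner_Integration.integral_norm_bound_integral[OF int1]) (auto simp: B)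
      then show ?thesis by (simp add: mult.commute)
    qed
    show "continuous_on UNIV ?g"
      unfolding continuous_on_sequentially
    proof (intro allI ballI impI)
      fix x :: "nat \<Rightarrow> real^'n" and a assume x: "(\<forall>n. x n \<in> UNIV) \<and> x \<longlonglongrightarrow> a"
      show "(?g \<circ> x) \<longlonglongrightarrow> ?g a"
        unfolding comp_def
      proof (rule integral_dominated_convergence[where w = "\<lambda>_. B"])
        have "(\<lambda>n. \<phi> (x n - z)) \<longlonglongrightarrow> \<phi> (a - z)" for z
          using x by (intro continuous_on_tendsto_compose[OF schwartz_continuous[OF \<phi>]] tendsto_intros) auto
        then show "AE z in M. (\<lambda>n. \<phi> (x n - z)) \<longlonglongrightarrow> \<phi> (a - z)" by simp
      qed (auto simp: B)
    qed
  qed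
  then show ?thesis by (simp add: inv)
qed

end

text \<open>
  The function \<open>g\<close> represents the multiplier operator with symbol \<open>m\<close>
  applied to \<open>f\<close>. For a function \<open>f\<close> in \<open>L\<^sup>p\<close> the
  operator is defined by transposition to Schwartz functions, which is the form in which the
  ratio of the two symbols appears in \<open>fourier_multiplier_transfer\<close>.
\<close>
definition weak_multiplier :: "(real^'n::finite \<Rightarrow> real) \<Rightarrow> (real^'n \<Rightarrow> complex) \<Rightarrow> (real^'n \<Rightarrow> complex) \<Rightarrow> bool" where
  "weak_multiplier m f g \<longleftrightarrow> (\<forall>\<phi>\<in>schwartz.
     (\<integral>x. f x * fourier (\<lambda>\<xi>. of_real (m \<xi>) * inverse_fourier \<phi> \<xi>) x \<partial>lborel) = (\<integral>x. g x * \<phi> x \<partial>lborel))"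

lemma weak_multiplierI:
  "(\<And>\<phi>. \<phi> \<in> schwartz \<Longrightarrow> (\<integral>x. f x * fourier (\<lambda>\<xi>. of_real (m \<xi>) * inverse_fourier \<phi> \<xi>) x \<partial>lborel) = (\<integral>x. g x * \<phi> x \<partial>lborel)) \<Longrightarrow> weak_multiplier m f g"
  by (simp add: weak_multiplier_def)

lemma weak_multiplierD:
  "weak_multiplier m f g \<Longrightarrow> \<phi> \<in> schwartz \<Longrightarrow> (\<integral>x. f x * fourier (\<lambda>\<xi>. of_real (m \<xi>) * inverse_fourier \<phi> \<xi>) x \<partial>lborel) = (\<integral>x. g x * \<phi> x \<partial>lborel)"
  by (simp add: weak_multiplier_def)

text \<open>
  Membership in \<open>symbols\<close> keeps the transposed operator inside the Schwartz class,
  so that multipliers can be composed.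
\<close>
definition Lp_multiplier :: "ennreal \<Rightarrow> (real^'n::finite \<Rightarrow> real) \<Rightarrow> bool" where
  "Lp_multiplier p m \<longleftrightarrow> (\<lambda>\<xi>. complex_of_real (m \<xi>)) \<in> symbols \<and>
     (\<exists>C\<ge>0. \<forall>f\<in>borel_measurable borel. \<forall>K\<ge>0. Lp_bound p f K \<longrightarrow>
       (\<exists>g\<in>borel_measurable borel. Lp_bound p g (C * K) \<and> weak_multiplier m f g))"

lemma Lp_multiplier_symbol: "Lp_multiplier p m \<Longrightarrow> (\<lambda>\<xi>. complex_of_real (m \<xi>)) \<in> symbols"
  by (simp add: Lp_multiplier_def)

lemma Lp_multiplier_measure:
  fixes m :: "real^'n::finite \<Rightarrow> real"
  assumes "finite_borel_measure M" and p: "1 \<le> p"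
    and m: "(\<lambda>\<xi>. complex_of_real (m \<xi>)) \<in> symbols" and M: "\<And>\<xi>. of_real (m \<xi>) = (\<integral>z. cis (2 * pi * (z \<bullet> \<xi>)) \<partial>M)"
  shows "Lp_multiplier p m"
proof -
  interpret finite_borel_measure M by fact
  \<comment> \<open>Adding one makes \<open>c\<close> positive also when \<open>M\<close> is the null measure.\<close>
  define c where "c = measure M (space M) + 1"
  have c: "0 < c" "measure M (space M) \<le> c" by (auto simp: c_def intro: add_nonneg_pos)
  have "\<exists>g\<in>borel_measurable borel. Lp_bound p g (c * K) \<and> weak_multiplier m f g"
    if f: "f \<in> borel_measurable borel" "Lp_bound p f K" and K: "K \<ge> 0" for f :: "real^'n \<Rightarrow> complex" and K
  proof (intro bexI conjI weak_multiplierI)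
    note [measurable] = f(1)
    show "(\<lambda>x. \<integral>z. f (x + z) \<partial>M) \<in> borel_measurable borel" by measurable
    show "Lp_bound p (\<lambda>x. \<integral>z. f (x + z) \<partial>M) (c * K)"
      by (rule Lp_bound_convolution[OF f(1) p f(2) c K])
    show "(\<integral>x. f x * fourier (\<lambda>\<xi>. of_real (m \<xi>) * inverse_fourier \<phi> \<xi>) x \<partial>lborel) = (\<integral>x. (\<integral>z. f (x + z) \<partial>M) * \<phi> x \<partial>lborel)"
      if "\<phi> \<in> schwartz" for \<phi>
      unfolding fourier_multiplier_convolution[OF that m M] by (rule Lp_convolution_duality[OF f(1) p f(2) that])
  qed
  then show ?thesis unfolding Lp_multiplier_def using m c by (intro conjI exI[of _ c]) auto
qed

lemma fourier_cmult: "fourier (\<lambda>x. c * \<phi> x) = (\<lambda>\<xi>. c * fourier \<phi> \<xi>)"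
  by (simp add: fourier_cis fun_eq_iff mult.assoc)

lemma Lp_bound_cmult:
  fixes f :: "real^'n::finite \<Rightarrow> complex"
  assumes [measurable]: "f \<in> borel_measurable borel" and p: "1 \<le> p" and f: "Lp_bound p f K" and K: "K \<ge> 0"
  shows "Lp_bound p (\<lambda>x. c * f x) (norm c * K)"
proof (cases "p = top")
  case True
  then show ?thesis
    using f by (auto simp: Lp_bound_top norm_mult elim!: eventually_mono intro!: mult_left_mono)
next
  case False
  have "(\<integral>\<^sup>+x. ennreal (norm (c * f x) powr enn2real p) \<partial>lborel) =
      ennreal (norm c powr enn2real p) * (\<integral>\<^sup>+x. ennreal (norm (f x) powr enn2real p) \<partial>lborel)"
    by (simp add: norm_mult powr_mult ennreal_mult nn_integral_cmult)
  also have "\<dots> \<le> ennreal (norm c powr enn2real p) * ennreal (K powr enn2real p)"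
    using f False by (intro mult_left_mono) (auto simp: Lp_bound_finite)
  finally show ?thesis
    using False K by (simp add: Lp_bound_finite powr_mult ennreal_mult)
qed

text \<open>
  A quasi-triangle inequality from \<open>|f + g| \<le> 2 max |f| |g|\<close>; the value of the
  constant does not matter for multipliers.
\<close>
lemma Lp_bound_add:
  fixes f g :: "real^'n::finite \<Rightarrow> complex"
  assumes [measurable]: "f \<in> borel_measurable borel" "g \<in> borel_measurable borel" and p: "1 \<le> p"
    and f: "Lp_bound p f K" and g: "Lp_bound p g L" and K: "K \<ge> 0" "L \<ge> 0"
  shows "Lp_bound p (\<lambda>x. f x + g x) (4 * (K + L))"
proof (cases "p = top")
  case True
  have "AE x in lborel. norm (f x) \<le> K" "AE x in lborel. norm (g x) \<le> L"
    using f g True by (auto simp: Lp_bound_top)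
  then have "AE x in lborel. norm (f x + g x) \<le> 4 * (K + L)"
  proof eventually_elim
    case (elim x)
    then have "norm (f x + g x) \<le> K + L" using norm_triangle_ineq[of "f x" "g x"] by linarith
    also have "\<dots> \<le> 4 * (K + L)" using K by simp
    finally show ?case .
  qed
  then show ?thesis using True by (simp add: Lp_bound_top)
next
  case False
  define r where "r = enn2real p"
  have r: "r \<ge> 1" using enn2real_ge_1[OF p False] by (simp add: r_def)
  have le: "norm (f x + g x) powr r \<le> 2 powr r * (norm (f x) powr r + norm (g x) powr r)" for x
  proof -
    have "norm (f x + g x) powr r \<le> (2 * max (norm (f x)) (norm (g x))) powr r"
      using norm_triangle_ineq[of "f x" "g x"] r by (intro powr_mono2) auto
    also have "\<dots> = 2 powr r * max (norm (f x)) (norm (g x)) powr r"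
      by (simp add: powr_mult)
    also have "\<dots> \<le> 2 powr r * (norm (f x) powr r + norm (g x) powr r)"
      by (intro mult_left_mono) (auto simp: max_def)
    finally show ?thesis .
  qed
  have "(\<integral>\<^sup>+x. ennreal (norm (f x + g x) powr r) \<partial>lborel) \<le>
      (\<integral>\<^sup>+x. ennreal (2 powr r) * (ennreal (norm (f x) powr r) + ennreal (norm (g x) powr r)) \<partial>lborel)"
    by (intro nn_integral_mono) (simp add: le flip: ennreal_plus ennreal_mult)
  also have "\<dots> = ennreal (2 powr r) * ((\<integral>\<^sup>+x. ennreal (norm (f x) powr r) \<partial>lborel) + (\<integral>\<^sup>+x. ennreal (norm (g x) powr r) \<partial>lborel))"
    by (simp add: nn_integral_cmult nn_integral_add)
  also have "\<dots> \<le> ennreal (2 powr r) * (ennreal (K powr r) + ennreal (L powr r))"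
    using f g False by (intro mult_left_mono add_mono) (auto simp: Lp_bound_finite r_def)
  also have "\<dots> = ennreal (2 powr r * (K powr r + L powr r))"
    by (simp flip: ennreal_plus ennreal_mult)
  also have "2 powr r * (K powr r + L powr r) \<le> 2 powr r * (2 powr r * (K + L) powr r)"
  proof (intro mult_left_mono)
    have "K powr r + L powr r \<le> 2 * (K + L) powr r"
      using K r powr_mono2[of r K "K + L"] powr_mono2[of r L "K + L"] by simp
    also have "\<dots> \<le> 2 powr r * (K + L) powr r"
      using r powr_mono[of 1 r 2] by (intro mult_right_mono) auto
    finally show "K powr r + L powr r \<le> 2 powr r * (K + L) powr r" .
  qed simp
  also have "\<dots> = (4 * (K + L)) powr r"
  proof -
    have "(4::real) powr r = 2 powr r * 2 powr r" by (simp flip: powr_mult)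
    then show ?thesis using K by (simp add: powr_mult del: distrib_left_numeral)
  qed
  finally show ?thesis using False by (simp add: Lp_bound_finite ennreal_leI flip: r_def)
qed

lemma Lp_multiplierE:
  assumes "Lp_multiplier p m"
  obtains C where "C \<ge> 0" "\<And>f K. f \<in> borel_measurable borel \<Longrightarrow> K \<ge> 0 \<Longrightarrow> Lp_bound p f K \<Longrightarrow>
    \<exists>g\<in>borel_measurable borel. Lp_bound p g (C * K) \<and> weak_multiplier m f g"
  using assms unfolding Lp_multiplier_def by blast

lemma schwartz_multiplier:
  "m \<in> symbols \<Longrightarrow> \<phi> \<in> schwartz \<Longrightarrow> fourier (\<lambda>\<xi>. m \<xi> * inverse_fourier \<phi> \<xi>) \<in> schwartz"
  by (intro schwartz_fourier schwartz_symbol_mult schwartz_inverse_fourier)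

lemma Lp_multiplier_const:
  assumes p: "1 \<le> p" shows "Lp_multiplier p (\<lambda>_::real^'n::finite. c)"
proof -
  have "\<exists>g\<in>borel_measurable borel. Lp_bound p g (norm (complex_of_real c) * K) \<and> weak_multiplier (\<lambda>_. c) f g"
    if f: "f \<in> borel_measurable borel" "Lp_bound p f K" and K: "K \<ge> 0" for f :: "real^'n \<Rightarrow> complex" and K
    using f Lp_bound_cmult[OF f(1) p f(2) K, of "of_real c"]
    by (intro bexI[of _ "\<lambda>x. of_real c * f x"] conjI weak_multiplierI)
      (auto simp: fourier_cmult fourier_inverse_fourier_schwartz mult_ac)
  then show ?thesis
    unfolding Lp_multiplier_def using symbols.const by (intro conjI exI[of _ "norm (complex_of_real c)"]) auto
qed

text \<open>
  Products of symbols correspond to compositions of operators: the transposed operator of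
  \<open>n\<close> maps a test function to a Schwartz function again, to which the
  representation for \<open>m\<close> applies.
\<close>
lemma Lp_multiplier_mult:
  fixes m n :: "real^'n::finite \<Rightarrow> real"
  assumes m: "Lp_multiplier p m" and n: "Lp_multiplier p n"
  shows "Lp_multiplier p (\<lambda>\<xi>. m \<xi> * n \<xi>)"
proof -
  note sm = Lp_multiplier_symbol[OF m] and sn = Lp_multiplier_symbol[OF n]
  obtain C where C: "C \<ge> 0" "\<And>f K. f \<in> borel_measurable borel \<Longrightarrow> K \<ge> 0 \<Longrightarrow> Lp_bound p f K \<Longrightarrow>
    \<exists>g\<in>borel_measurable borel. Lp_bound p g (C * K) \<and> weak_multiplier m f g"
    using Lp_multiplierE[OF m] by blast
  obtain D where D: "D \<ge> 0" "\<And>f K. f \<in> borel_measurable borel \<Longrightarrow> K \<ge> 0 \<Longrightarrow> Lp_bound p f K \<Longrightarrow>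
    \<exists>g\<in>borel_measurable borel. Lp_bound p g (D * K) \<and> weak_multiplier n f g"
    using Lp_multiplierE[OF n] by blast
  have "\<exists>g\<in>borel_measurable borel. Lp_bound p g ((D * C) * K) \<and> weak_multiplier (\<lambda>\<xi>. m \<xi> * n \<xi>) f g"
    if f: "f \<in> borel_measurable borel" "Lp_bound p f K" and K: "K \<ge> 0" for f :: "real^'n \<Rightarrow> complex" and K
  proof -
    obtain g where g: "g \<in> borel_measurable borel" "Lp_bound p g (C * K)" "weak_multiplier m f g"
      using C(2)[OF f(1) K f(2)] by blast
    obtain h where h: "h \<in> borel_measurable borel" "Lp_bound p h (D * (C * K))" "weak_multiplier n g h"
      using D(2)[OF g(1) _ g(2)] C(1) K by auto
    have "(\<integral>x. f x * fourier (\<lambda>\<xi>. of_real (m \<xi> * n \<xi>) * inverse_fourier \<phi> \<xi>) x \<partial>lborel) = (\<integral>x. h x * \<phi> x \<partial>lborel)"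
      if \<phi>: "\<phi> \<in> schwartz" for \<phi>
    proof -
      let ?\<psi> = "fourier (\<lambda>\<xi>. of_real (n \<xi>) * inverse_fourier \<phi> \<xi>)"
      have "inverse_fourier ?\<psi> = (\<lambda>\<xi>. of_real (n \<xi>) * inverse_fourier \<phi> \<xi>)"
        by (intro inverse_fourier_fourier_schwartz schwartz_symbol_mult schwartz_inverse_fourier sn \<phi>)
      then have "fourier (\<lambda>\<xi>. of_real (m \<xi> * n \<xi>) * inverse_fourier \<phi> \<xi>) = fourier (\<lambda>\<xi>. of_real (m \<xi>) * inverse_fourier ?\<psi> \<xi>)"
        by (simp add: mult.assoc)
      then show ?thesis
        using weak_multiplierD[OF g(3) schwartz_multiplier[OF sn \<phi>]] weak_multiplierD[OF h(3) \<phi>] by simp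
    qed
    then have "weak_multiplier (\<lambda>\<xi>. m \<xi> * n \<xi>) f h" by (rule weak_multiplierI)
    with h(1,2) show ?thesis by (auto simp: mult.assoc)
  qed
  moreover have "(\<lambda>\<xi>. complex_of_real (m \<xi> * n \<xi>)) \<in> symbols"
    using symbols.mult[OF sm sn] by simp
  ultimately show ?thesis
    unfolding Lp_multiplier_def using C(1) D(1) by (intro conjI exI[of _ "D * C"]) auto
qed

lemma Lp_multiplier_add:
  fixes m n :: "real^'n::finite \<Rightarrow> real"
  assumes p: "1 \<le> p" and m: "Lp_multiplier p m" and n: "Lp_multiplier p n"
  shows "Lp_multiplier p (\<lambda>\<xi>. m \<xi> + n \<xi>)"
proof -
  note sm = Lp_multiplier_symbol[OF m] and sn = Lp_multiplier_symbol[OF n]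
  obtain C where C: "C \<ge> 0" "\<And>f K. f \<in> borel_measurable borel \<Longrightarrow> K \<ge> 0 \<Longrightarrow> Lp_bound p f K \<Longrightarrow>
    \<exists>g\<in>borel_measurable borel. Lp_bound p g (C * K) \<and> weak_multiplier m f g"
    using Lp_multiplierE[OF m] by blast
  obtain D where D: "D \<ge> 0" "\<And>f K. f \<in> borel_measurable borel \<Longrightarrow> K \<ge> 0 \<Longrightarrow> Lp_bound p f K \<Longrightarrow>
    \<exists>g\<in>borel_measurable borel. Lp_bound p g (D * K) \<and> weak_multiplier n f g"
    using Lp_multiplierE[OF n] by blast
  have "\<exists>g\<in>borel_measurable borel. Lp_bound p g ((4 * (C + D)) * K) \<and> weak_multiplier (\<lambda>\<xi>. m \<xi> + n \<xi>) f g"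
    if f: "f \<in> borel_measurable borel" "Lp_bound p f K" and K: "K \<ge> 0" for f :: "real^'n \<Rightarrow> complex" and K
  proof -
    obtain g where g: "g \<in> borel_measurable borel" "Lp_bound p g (C * K)" "weak_multiplier m f g"
      using C(2)[OF f(1) K f(2)] by blast
    obtain h where h: "h \<in> borel_measurable borel" "Lp_bound p h (D * K)" "weak_multiplier n f h"
      using D(2)[OF f(1) K f(2)] by blast
    have "(\<integral>x. f x * fourier (\<lambda>\<xi>. of_real (m \<xi> + n \<xi>) * inverse_fourier \<phi> \<xi>) x \<partial>lborel) = (\<integral>x. (g x + h x) * \<phi> x \<partial>lborel)"
      if \<phi>: "\<phi> \<in> schwartz" for \<phi>
    proof -
      let ?m = "\<lambda>\<xi>. of_real (m \<xi>) * inverse_fourier \<phi> \<xi>" and ?n = "\<lambda>\<xi>. of_real (n \<xi>) * inverse_fourier \<phi> \<xi>"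
      have S: "?m \<in> schwartz" "?n \<in> schwartz"
        by (intro schwartz_symbol_mult schwartz_inverse_fourier sm sn \<phi>)+
      have int: "integrable lborel (\<lambda>x. ?m x * cis (- (2 * pi * (x \<bullet> \<xi>))))" "integrable lborel (\<lambda>x. ?n x * cis (- (2 * pi * (x \<bullet> \<xi>))))" for \<xi>
        by (intro integrable_mult_cis schwartz_integrable S; measurable)+
      have "fourier (\<lambda>\<xi>. of_real (m \<xi> + n \<xi>) * inverse_fourier \<phi> \<xi>) x = fourier ?m x + fourier ?n x" for x
        unfolding fourier_cis Bochner_Integration.integral_add[OF int, symmetric]
        by (simp add: algebra_simps)
      then have "(\<integral>x. f x * fourier (\<lambda>\<xi>. of_real (m \<xi> + n \<xi>) * inverse_fourier \<phi> \<xi>) x \<partial>lborel) =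
          (\<integral>x. f x * fourier ?m x + f x * fourier ?n x \<partial>lborel)"
        by (simp add: distrib_left)
      also have "\<dots> = (\<integral>x. f x * fourier ?m x \<partial>lborel) + (\<integral>x. f x * fourier ?n x \<partial>lborel)"
        by (intro Bochner_Integration.integral_add Lp_schwartz_integrable[OF f(1) p f(2)] schwartz_fourier S)
      also have "\<dots> = (\<integral>x. g x * \<phi> x \<partial>lborel) + (\<integral>x. h x * \<phi> x \<partial>lborel)"
        by (simp only: weak_multiplierD[OF g(3) \<phi>] weak_multiplierD[OF h(3) \<phi>])
      also have "\<dots> = (\<integral>x. g x * \<phi> x + h x * \<phi> x \<partial>lborel)"
        by (intro Bochner_Integration.integral_add[symmetric] Lp_schwartz_integrable[OF g(1) p g(2)] Lp_schwartz_integrable[OF h(1) p h(2)] \<phi>)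
      finally show ?thesis by (simp add: distrib_right)
    qed
    then have "weak_multiplier (\<lambda>\<xi>. m \<xi> + n \<xi>) f (\<lambda>x. g x + h x)" by (rule weak_multiplierI)
    moreover have "Lp_bound p (\<lambda>x. g x + h x) (4 * (C * K + D * K))"
      using C(1) D(1) K by (intro Lp_bound_add g h p) auto
    ultimately show ?thesis
      using g(1) h(1) by (intro bexI[of _ "\<lambda>x. g x + h x"]) (auto simp: algebra_simps)
  qed
  moreover have "(\<lambda>\<xi>. complex_of_real (m \<xi> + n \<xi>)) \<in> symbols"
    using symbols.add[OF sm sn] by simp
  ultimately show ?thesis
    unfolding Lp_multiplier_def using C(1) D(1) by (intro conjI exI[of _ "4 * (C + D)"]) auto
qed

lemma Lp_multiplier_power:
  "1 \<le> p \<Longrightarrow> Lp_multiplier p m \<Longrightarrow> Lp_multiplier p (\<lambda>\<xi>. m \<xi> ^ k)"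
  by (induction k) (auto intro: Lp_multiplier_const Lp_multiplier_mult)

section \<open>Multipliers that are Laplace transforms\<close>

text \<open>
  A Laplace transform in \<open>t = 4\<pi>\<^sup>2|\<xi>|\<^sup>2\<close> of a positive measure
  on the half line is a mixture of heat semigroups. The corresponding measure on the space is
  the law of \<open>2 \<surd>(\<pi>\<tau>) z\<close> with \<open>z\<close> distributed by
  \<open>gauss\<close>. Its mass is the value of the transform at \<open>\<xi> = 0\<close>,
  hence finite because \<open>m\<close> takes real values.
\<close>
lemma Lp_multiplier_laplace:
  fixes m :: "real^'n::finite \<Rightarrow> real" and k :: "real \<Rightarrow> ennreal"
  assumes p: "1 \<le> p" and sym: "(\<lambda>\<xi>. complex_of_real (m \<xi>)) \<in> symbols"
    and [measurable]: "k \<in> borel_measurable borel" and k0: "\<And>\<tau>. \<tau> < 0 \<Longrightarrow> k \<tau> = 0"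
    and m0: "\<And>\<xi>. m \<xi> \<ge> 0"
    and m: "\<And>\<xi>. ennreal (m \<xi>) = (\<integral>\<^sup>+\<tau>. k \<tau> * ennreal (exp (- (\<tau> * (4 * pi\<^sup>2 * (norm \<xi>)\<^sup>2)))) \<partial>lborel)"
  shows "Lp_multiplier p m"
proof -
  define N where "N = density lborel k"
  define G where "G = density lborel (\<lambda>z::real^'n. ennreal (gauss z))"
  define M where "M = distr (N \<Otimes>\<^sub>M G) borel (\<lambda>(\<tau>, z). (2 * sqrt (pi * \<tau>)) *\<^sub>R z)"
  have sets [measurable_cong]: "sets N = sets borel" "sets G = sets borel" "sets M = sets borel"
    by (simp_all add: N_def G_def M_def)
  have "emeasure N (space N) = ennreal (m 0)"
    unfolding N_def using m[of 0] by (simp add: emeasure_density)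
  then interpret N: finite_measure N by (intro finite_measureI) simp
  have "(\<integral>\<^sup>+z. ennreal (gauss (z::real^'n)) \<partial>lborel) = 1"
    by (subst nn_integral_eq_integral[OF integrable_gauss]) (simp_all add: integral_gauss)
  then have "emeasure G (space G) = 1"
    by (simp add: G_def emeasure_density)
  then interpret G: finite_measure G by (intro finite_measureI) simp
  interpret NG: pair_sigma_finite N G ..
  have [measurable]: "(\<lambda>(\<tau>, z). (2 * sqrt (pi * \<tau>)) *\<^sub>R z) \<in> N \<Otimes>\<^sub>M G \<rightarrow>\<^sub>M (borel :: (real^'n) measure)"
    by measurable
  interpret P: finite_measure "N \<Otimes>\<^sub>M G"
    by (intro finite_measure_pair_measure N.finite_measure_axioms G.finite_measure_axioms)
  have fin: "finite_measure M" unfolding M_def by (rule P.finite_measure_distr) measurable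
  show ?thesis
  proof (rule Lp_multiplier_measure[OF _ p sym])
    show "finite_borel_measure M"
      by (intro finite_borel_measure.intro fin finite_borel_measure_axioms.intro sets)
    fix \<xi> :: "real^'n"
    have "(\<integral>z. cis (2 * pi * (z \<bullet> \<xi>)) \<partial>M) = (\<integral>(\<tau>, z). cis (2 * pi * (((2 * sqrt (pi * \<tau>)) *\<^sub>R z) \<bullet> \<xi>)) \<partial>(N \<Otimes>\<^sub>M G))"
      unfolding M_def by (subst integral_distr) (simp_all add: split_beta')
    also have "\<dots> = (\<integral>\<tau>. (\<integral>z. cis (2 * pi * (((2 * sqrt (pi * \<tau>)) *\<^sub>R z) \<bullet> \<xi>)) \<partial>G) \<partial>N)"
    proof -
      have "integrable (N \<Otimes>\<^sub>M G) (\<lambda>(\<tau>, z). cis (2 * pi * (((2 * sqrt (pi * \<tau>)) *\<^sub>R z) \<bullet> \<xi>)))"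
        by (rule P.integrable_const_bound[where B = 1]) auto
      from NG.integral_fst'[OF this] show ?thesis by simp
    qed
    also have "(\<lambda>\<tau>. \<integral>z. cis (2 * pi * (((2 * sqrt (pi * \<tau>)) *\<^sub>R z) \<bullet> \<xi>)) \<partial>G) = (\<lambda>\<tau>. of_real (gauss ((2 * sqrt (pi * \<tau>)) *\<^sub>R \<xi>)))"
    proof
      fix \<tau>
      let ?c = "2 * sqrt (pi * \<tau>)"
      have "(\<integral>z. cis (2 * pi * ((?c *\<^sub>R z) \<bullet> \<xi>)) \<partial>G) = (\<integral>z. gauss z *\<^sub>R cis (2 * pi * ((?c *\<^sub>R z) \<bullet> \<xi>)) \<partial>lborel)"
        unfolding G_def by (rule integral_density; measurable)
      also have "\<dots> = (\<integral>z. complex_of_real (gauss z) * cis (2 * pi * (z \<bullet> (?c *\<^sub>R \<xi>))) \<partial>lborel)"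
      proof (rule Bochner_Integration.integral_cong[OF refl])
        fix z
        have "(?c *\<^sub>R z) \<bullet> \<xi> = z \<bullet> (?c *\<^sub>R \<xi>)" by (simp only: inner_scaleR_left inner_scaleR_right)
        then show "gauss z *\<^sub>R cis (2 * pi * ((?c *\<^sub>R z) \<bullet> \<xi>)) = complex_of_real (gauss z) * cis (2 * pi * (z \<bullet> (?c *\<^sub>R \<xi>)))"
          by (metis scaleR_conv_of_real)
      qed
      finally have "(\<integral>z. cis (2 * pi * ((?c *\<^sub>R z) \<bullet> \<xi>)) \<partial>G) =
          (\<integral>z. complex_of_real (gauss z) * cis (2 * pi * (z \<bullet> (?c *\<^sub>R \<xi>))) \<partial>lborel)" .
      then show "(\<integral>z. cis (2 * pi * (((2 * sqrt (pi * \<tau>)) *\<^sub>R z) \<bullet> \<xi>)) \<partial>G) = of_real (gauss ((2 * sqrt (pi * \<tau>)) *\<^sub>R \<xi>))"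
        by (simp only: fourier_gauss)
    qed
    also have "(\<integral>\<tau>. complex_of_real (gauss ((2 * sqrt (pi * \<tau>)) *\<^sub>R \<xi>)) \<partial>N) = of_real (\<integral>\<tau>. exp (- (\<tau> * (4 * pi\<^sup>2 * (norm \<xi>)\<^sup>2))) \<partial>N)"
    proof -
      have "AE \<tau> in N. \<tau> \<ge> 0"
      proof -
        have "0 < k \<tau> \<longrightarrow> \<tau> \<ge> 0" for \<tau> using k0[of \<tau>] by (cases "\<tau> < 0") auto
        then show ?thesis unfolding N_def by (subst AE_density) auto
      qed
      then have "AE \<tau> in N. gauss ((2 * sqrt (pi * \<tau>)) *\<^sub>R \<xi>) = exp (- (\<tau> * (4 * pi\<^sup>2 * (norm \<xi>)\<^sup>2)))"
        by eventually_elim (simp add: gauss_def power_mult_distrib power2_eq_square[of pi] mult_ac)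
      then have "(\<integral>\<tau>. gauss ((2 * sqrt (pi * \<tau>)) *\<^sub>R \<xi>) \<partial>N) = (\<integral>\<tau>. exp (- (\<tau> * (4 * pi\<^sup>2 * (norm \<xi>)\<^sup>2))) \<partial>N)"
        by (intro integral_cong_AE) auto
      then show ?thesis by simp
    qed
    also have "(\<integral>\<tau>. exp (- (\<tau> * (4 * pi\<^sup>2 * (norm \<xi>)\<^sup>2))) \<partial>N) = m \<xi>"
    proof -
      have "(\<integral>\<^sup>+\<tau>. ennreal (exp (- (\<tau> * (4 * pi\<^sup>2 * (norm \<xi>)\<^sup>2)))) \<partial>N) = ennreal (m \<xi>)"
        unfolding m N_def by (subst nn_integral_density) auto
      then show ?thesis
        using m0 by (subst integral_eq_nn_integral) auto
    qed
    finally show "of_real (m \<xi>) = (\<integral>z. cis (2 * pi * (z \<bullet> \<xi>)) \<partial>M)" by simp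
  qed
qed

text \<open>
  The function of \<open>\<tau>\<close> whose Laplace transform at \<open>t\<close> is \<open>(c
  + t)\<^bsup>-\<beta>\<^esup>\<close>. With the entire function \<open>rGamma\<close> it is
  jointly measurable in all arguments, as needed for mixing over \<open>c\<close> and
  \<open>\<beta>\<close>.
\<close>
definition gamma_kernel :: "real \<Rightarrow> real \<Rightarrow> real \<Rightarrow> real" where
  "gamma_kernel c \<beta> \<tau> = indicator {0<..} \<tau> * \<tau> powr (\<beta> - 1) * exp (- (c * \<tau>)) * rGamma \<beta>"

lemma borel_measurable_rGamma [measurable]: "(rGamma :: real \<Rightarrow> real) \<in> borel_measurable borel"
  by (intro borel_measurable_continuous_onI continuous_intros)

lemma gamma_kernel_exp: "gamma_kernel c \<beta> \<tau> * exp (- (\<tau> * t)) = gamma_kernel (c + t) \<beta> \<tau>"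
  by (simp add: gamma_kernel_def exp_add[symmetric] algebra_simps)

lemma nn_integral_gamma_kernel:
  assumes \<beta>: "\<beta> > 0" and c: "c > 0"
  shows "(\<integral>\<^sup>+\<tau>. ennreal (gamma_kernel c \<beta> \<tau>) \<partial>lborel) = ennreal (c powr (- \<beta>))"
proof -
  have G: "Gamma \<beta> > 0" using \<beta> by (rule Gamma_real_pos)
  have eq: "ennreal (gamma_kernel c \<beta> (0 + inverse c * x)) =
      ennreal (c powr (1 - \<beta>) / Gamma \<beta>) * ennreal (indicator {0..} x * x powr (\<beta> - 1) / exp x)" for x
  proof (cases "x > 0")
    case True
    then have "(inverse c * x) powr (\<beta> - 1) = c powr (1 - \<beta>) * x powr (\<beta> - 1)"
      using c by (simp add: powr_mult powr_minus[symmetric] flip: powr_powr[of c "-1"]) (simp add: inverse_eq_divide powr_divide powr_diff)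
    then show ?thesis
      using True c G by (simp add: gamma_kernel_def rGamma_inverse_Gamma exp_minus divide_inverse mult_ac flip: ennreal_mult)
  next
    case False
    then show ?thesis using c by (auto simp: gamma_kernel_def indicator_def mult_less_0_iff zero_less_mult_iff)
  qed
  have "(\<integral>\<^sup>+\<tau>. ennreal (gamma_kernel c \<beta> \<tau>) \<partial>lborel) =
      ennreal \<bar>inverse c\<bar> * (\<integral>\<^sup>+x. ennreal (gamma_kernel c \<beta> (0 + inverse c * x)) \<partial>lborel)"
    using c by (intro nn_integral_real_affine) (auto simp: gamma_kernel_def)
  also have "(\<integral>\<^sup>+x. ennreal (gamma_kernel c \<beta> (0 + inverse c * x)) \<partial>lborel) =
      ennreal (c powr (1 - \<beta>) / Gamma \<beta>) * ennreal (Gamma \<beta>)"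
    unfolding eq by (simp add: nn_integral_cmult Gamma_conv_nn_integral_real[OF \<beta>])
  also have "\<dots> = ennreal (c powr (1 - \<beta>))"
    using G by (simp flip: ennreal_mult)
  also have "ennreal \<bar>inverse c\<bar> * \<dots> = ennreal (c powr (- \<beta>))"
    using c by (simp add: powr_diff powr_minus divide_inverse flip: ennreal_mult)
  finally show ?thesis .
qed

text \<open>
  Mixtures of negative powers of \<open>laplace_symbol\<close> are Laplace transforms of the
  corresponding mixtures of gamma kernels, by Tonelli's theorem.
\<close>
lemma Lp_multiplier_bessel_mixture:
  fixes m :: "real^'n::finite \<Rightarrow> real" and w c \<beta> :: "real \<Rightarrow> real"
  assumes p: "1 \<le> p" and sym: "(\<lambda>\<xi>. complex_of_real (m \<xi>)) \<in> symbols"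
    and [measurable]: "w \<in> borel_measurable borel" "c \<in> borel_measurable borel" "\<beta> \<in> borel_measurable borel"
    and w: "\<And>r. w r \<ge> 0" and c: "\<And>r. w r \<noteq> 0 \<Longrightarrow> c r > 0" and \<beta>: "\<And>r. w r \<noteq> 0 \<Longrightarrow> \<beta> r > 0"
    and m0: "\<And>\<xi>. m \<xi> \<ge> 0"
    and m: "\<And>\<xi>. ennreal (m \<xi>) = (\<integral>\<^sup>+r. ennreal (w r * laplace_symbol (c r) \<xi> powr (- \<beta> r)) \<partial>lborel)"
  shows "Lp_multiplier p m"
proof (rule Lp_multiplier_laplace[OF p sym _ _ m0])
  let ?k = "\<lambda>\<tau>. \<integral>\<^sup>+r. ennreal (w r * gamma_kernel (c r) (\<beta> r) \<tau>) \<partial>lborel"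
  have [measurable]: "(\<lambda>x. gamma_kernel (c (f x)) (\<beta> (f x)) (g x)) \<in> borel_measurable M"
    if [measurable]: "f \<in> borel_measurable M" "g \<in> borel_measurable M" for f g and M :: "'b measure"
    unfolding gamma_kernel_def by measurable
  show "?k \<in> borel_measurable borel" by measurable
  show "?k \<tau> = 0" if "\<tau> < 0" for \<tau> using that by (simp add: gamma_kernel_def)
  fix \<xi> :: "real^'n"
  define t where "t = 4 * pi\<^sup>2 * (norm \<xi>)\<^sup>2"
  have t: "t \<ge> 0" by (simp add: t_def)
  have "(\<integral>\<^sup>+\<tau>. ?k \<tau> * ennreal (exp (- (\<tau> * t))) \<partial>lborel) =
      (\<integral>\<^sup>+\<tau>. (\<integral>\<^sup>+r. ennreal (w r * gamma_kernel (c r) (\<beta> r) \<tau>) * ennreal (exp (- (\<tau> * t))) \<partial>lborel) \<partial>lborel)"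
    by (intro nn_integral_cong nn_integral_multc[symmetric]) measurable
  also have "\<dots> = (\<integral>\<^sup>+\<tau>. (\<integral>\<^sup>+r. ennreal (w r * gamma_kernel (c r + t) (\<beta> r) \<tau>) \<partial>lborel) \<partial>lborel)"
    by (intro nn_integral_cong) (simp add: gamma_kernel_exp mult.assoc flip: ennreal_mult'')
  also have "\<dots> = (\<integral>\<^sup>+r. (\<integral>\<^sup>+\<tau>. ennreal (w r * gamma_kernel (c r + t) (\<beta> r) \<tau>) \<partial>lborel) \<partial>lborel)"
    by (rule lborel_pair.Fubini') (unfold gamma_kernel_def, measurable)
  also have "\<dots> = (\<integral>\<^sup>+r. ennreal (w r * laplace_symbol (c r) \<xi> powr (- \<beta> r)) \<partial>lborel)"
  proof (rule nn_integral_cong)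
    fix r
    show "(\<integral>\<^sup>+\<tau>. ennreal (w r * gamma_kernel (c r + t) (\<beta> r) \<tau>) \<partial>lborel) = ennreal (w r * laplace_symbol (c r) \<xi> powr (- \<beta> r))"
    proof (cases "w r = 0")
      case False
      have "(\<integral>\<^sup>+\<tau>. ennreal (w r * gamma_kernel (c r + t) (\<beta> r) \<tau>) \<partial>lborel) = (\<integral>\<^sup>+\<tau>. ennreal (w r) * ennreal (gamma_kernel (c r + t) (\<beta> r) \<tau>) \<partial>lborel)"
        using w by (simp add: ennreal_mult')
      also have "\<dots> = ennreal (w r) * ennreal ((c r + t) powr (- \<beta> r))"
        using nn_integral_gamma_kernel[OF \<beta>[OF False], of "c r + t"] c[OF False] t
        by (subst nn_integral_cmult) (auto simp: gamma_kernel_def)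
      finally show ?thesis using w by (simp add: ennreal_mult' laplace_symbol_def t_def)
    qed simp
  qed
  finally show "ennreal (m \<xi>) = (\<integral>\<^sup>+\<tau>. ?k \<tau> * ennreal (exp (- (\<tau> * (4 * pi\<^sup>2 * (norm \<xi>)\<^sup>2)))) \<partial>lborel)"
    by (simp add: m t_def)
qed

lemma laplace_symbol_pos: "c \<ge> 1 \<Longrightarrow> laplace_symbol c \<xi> > 0"
  using laplace_symbol_ge[of c \<xi>] by simp

lemma Lp_multiplier_bessel:
  assumes "1 \<le> p" "c \<ge> 1" "\<beta> > 0"
  shows "Lp_multiplier p (\<lambda>\<xi>::real^'n::finite. laplace_symbol c \<xi> powr (- \<beta>))"
proof (rule Lp_multiplier_bessel_mixture[where w = "indicator {0..1}" and c = "\<lambda>_. c" and \<beta> = "\<lambda>_. \<beta>", OF assms(1)])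
  show "(\<lambda>\<xi>::real^'n. complex_of_real (laplace_symbol c \<xi> powr (- \<beta>))) \<in> symbols"
    by (rule symbols.powr[OF assms(2)])
  show "ennreal (laplace_symbol c \<xi> powr (- \<beta>)) = (\<integral>\<^sup>+r. ennreal (indicator {0..1::real} r * laplace_symbol c \<xi> powr (- \<beta>)) \<partial>lborel)" for \<xi> :: "real^'n"
    by (simp add: ennreal_mult'' ennreal_indicator nn_integral_multc)
qed (use assms in auto)

text \<open>
  The integral of \<open>\<delta> (r + t)\<^bsup>\<delta>-1\<^esup>\<close> over \<open>1 \<le>
  r \<le> \<lambda>\<close>; the exponent is negative because \<open>\<delta> < 1\<close>.
\<close>
lemma Lp_multiplier_power_difference:
  assumes "1 \<le> p" "lam > 1" "0 < \<delta>" "\<delta> < 1"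
  shows "Lp_multiplier p (\<lambda>\<xi>::real^'n::finite. laplace_symbol lam \<xi> powr \<delta> - laplace_symbol 1 \<xi> powr \<delta>)"
proof (rule Lp_multiplier_bessel_mixture[where w = "\<lambda>r. \<delta> * indicator {1..lam} r" and c = "\<lambda>r. r" and \<beta> = "\<lambda>_. 1 - \<delta>", OF assms(1)])
  have "(\<lambda>\<xi>::real^'n. complex_of_real (laplace_symbol lam \<xi> powr \<delta>) + (-1) * complex_of_real (laplace_symbol 1 \<xi> powr \<delta>)) \<in> symbols"
    using assms by (intro symbols.add symbols_cmult symbols.powr) auto
  then show "(\<lambda>\<xi>::real^'n. complex_of_real (laplace_symbol lam \<xi> powr \<delta> - laplace_symbol 1 \<xi> powr \<delta>)) \<in> symbols"
    by simp
  show "laplace_symbol lam \<xi> powr \<delta> - laplace_symbol 1 \<xi> powr \<delta> \<ge> 0" for \<xi> :: "real^'n"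
    using assms laplace_symbol_pos[of 1 \<xi>] by (simp add: powr_mono2 laplace_symbol_def)
  show "ennreal (laplace_symbol lam \<xi> powr \<delta> - laplace_symbol 1 \<xi> powr \<delta>) =
      (\<integral>\<^sup>+r. ennreal (\<delta> * indicator {1..lam} r * laplace_symbol r \<xi> powr (- (1 - \<delta>))) \<partial>lborel)" for \<xi> :: "real^'n"
  proof -
    have "((\<lambda>r. laplace_symbol r \<xi> powr \<delta>) has_real_derivative \<delta> * laplace_symbol r \<xi> powr (\<delta> - 1)) (at r)" if "r \<ge> 1" for r
      using laplace_symbol_pos[OF that, of \<xi>] unfolding laplace_symbol_def by (auto intro!: derivative_eq_intros simp: powr_diff)
    then have "(\<integral>\<^sup>+r. ennreal (\<delta> * laplace_symbol r \<xi> powr (\<delta> - 1)) * indicator {1..lam} r \<partial>lborel) = ennreal (laplace_symbol lam \<xi> powr \<delta> - laplace_symbol 1 \<xi> powr \<delta>)"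
      using assms by (intro nn_integral_FTC_Icc) (auto simp: laplace_symbol_def)
    also have "(\<integral>\<^sup>+r. ennreal (\<delta> * laplace_symbol r \<xi> powr (\<delta> - 1)) * indicator {1..lam} r \<partial>lborel) = 
      (\<integral>\<^sup>+r. ennreal (\<delta> * indicator {1..lam} r * laplace_symbol r \<xi> powr (- (1 - \<delta>))) \<partial>lborel)"
      by (intro nn_integral_cong) (auto simp: indicator_def)
    finally show ?thesis by simp
  qed
qed (use assms in \<open>auto simp: indicator_def split: if_splits\<close>)

text \<open>
  The integral of \<open>(r + t)\<^bsup>-1\<^esup>\<close> over \<open>1 \<le> r \<le>
  \<lambda>\<close>.
\<close>
lemma Lp_multiplier_ln_difference:
  assumes "1 \<le> p" "lam > 1"
  shows "Lp_multiplier p (\<lambda>\<xi>::real^'n::finite. ln (laplace_symbol lam \<xi>) - ln (laplace_symbol 1 \<xi>))"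
proof (rule Lp_multiplier_bessel_mixture[where w = "indicator {1..lam}" and c = "\<lambda>r. r" and \<beta> = "\<lambda>_. 1", OF assms(1)])
  have "(\<lambda>\<xi>::real^'n. complex_of_real (ln (laplace_symbol lam \<xi>)) + (-1) * complex_of_real (ln (laplace_symbol 1 \<xi>))) \<in> symbols"
    using assms by (intro symbols.add symbols_cmult symbols.ln) auto
  then show "(\<lambda>\<xi>::real^'n. complex_of_real (ln (laplace_symbol lam \<xi>) - ln (laplace_symbol 1 \<xi>))) \<in> symbols"
    by simp
  show "ln (laplace_symbol lam \<xi>) - ln (laplace_symbol 1 \<xi>) \<ge> 0" for \<xi> :: "real^'n"
    using assms laplace_symbol_pos[of 1 \<xi>] laplace_symbol_pos[of lam \<xi>] by (simp add: laplace_symbol_def)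
  show "ennreal (ln (laplace_symbol lam \<xi>) - ln (laplace_symbol 1 \<xi>)) =
      (\<integral>\<^sup>+r. ennreal (indicator {1..lam} r * laplace_symbol r \<xi> powr (- 1)) \<partial>lborel)" for \<xi> :: "real^'n"
  proof -
    have "((\<lambda>r. ln (laplace_symbol r \<xi>)) has_real_derivative laplace_symbol r \<xi> powr (- 1)) (at r)" if "r \<ge> 1" for r
      using laplace_symbol_pos[OF that, of \<xi>] unfolding laplace_symbol_def by (auto intro!: derivative_eq_intros simp: powr_minus divide_inverse)
    then have "(\<integral>\<^sup>+r. ennreal (laplace_symbol r \<xi> powr (- 1)) * indicator {1..lam} r \<partial>lborel) = ennreal (ln (laplace_symbol lam \<xi>) - ln (laplace_symbol 1 \<xi>))"
      using assms by (intro nn_integral_FTC_Icc) (auto simp: laplace_symbol_def)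
    also have "(\<integral>\<^sup>+r. ennreal (laplace_symbol r \<xi> powr (- 1)) * indicator {1..lam} r \<partial>lborel) = 
      (\<integral>\<^sup>+r. ennreal (indicator {1..lam} r * laplace_symbol r \<xi> powr (- 1)) \<partial>lborel)"
      by (intro nn_integral_cong) (auto simp: indicator_def)
    finally show ?thesis by simp
  qed
qed (use assms in \<open>auto simp: indicator_def split: if_splits\<close>)

lemma ln_laplace_symbol_pos:
  assumes "c \<ge> 1" "d + ln c > 0" shows "d + ln (laplace_symbol c \<xi>) > 0"
proof -
  have "ln c \<le> ln (laplace_symbol c \<xi>)" using laplace_symbol_ge[of c \<xi>] assms by simp
  then show ?thesis using assms by linarith
qed

text \<open>
  The integral of \<open>e\<^bsup>-dr\<^esup> (c + t)\<^bsup>-r\<^esup> =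
  e\<^bsup>-(d+ln(c+t))r\<^esup>\<close> over \<open>r > 0\<close>.
\<close>
lemma Lp_multiplier_inverse_ln:
  assumes "1 \<le> p" "c \<ge> 1" "d + ln c > 0"
  shows "Lp_multiplier p (\<lambda>\<xi>::real^'n::finite. 1 / (d + ln (laplace_symbol c \<xi>)))"
proof (rule Lp_multiplier_bessel_mixture[where w = "\<lambda>r. indicator {0<..} r * exp (- (d * r))" and c = "\<lambda>_. c" and \<beta> = "\<lambda>r. r", OF assms(1)])
  show "(\<lambda>\<xi>::real^'n. complex_of_real (1 / (d + ln (laplace_symbol c \<xi>)))) \<in> symbols"
    using assms by (intro symbols.inv)
  show "1 / (d + ln (laplace_symbol c \<xi>)) \<ge> 0" for \<xi> :: "real^'n"
    using ln_laplace_symbol_pos[OF assms(2,3), of \<xi>] by simp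
  show "ennreal (1 / (d + ln (laplace_symbol c \<xi>))) =
      (\<integral>\<^sup>+r. ennreal (indicator {0<..} r * exp (- (d * r)) * laplace_symbol c \<xi> powr (- r)) \<partial>lborel)" for \<xi> :: "real^'n"
  proof -
    define b where "b = d + ln (laplace_symbol c \<xi>)"
    have b: "b > 0" unfolding b_def by (rule ln_laplace_symbol_pos[OF assms(2,3)])
    have "(\<integral>\<^sup>+r. ennreal (indicator {0<..} r * exp (- (d * r)) * laplace_symbol c \<xi> powr (- r)) \<partial>lborel) =
        (\<integral>\<^sup>+r. ennreal (exp (- (b * r))) * indicator {0..} r \<partial>lborel)"
    proof (rule nn_integral_cong_AE)
      have "AE r::real in lborel. r \<noteq> 0" by (rule AE_lborel_singleton)
      then show "AE r in lborel. ennreal (indicator {0<..} r * exp (- (d * r)) * laplace_symbol c \<xi> powr (- r)) =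
          ennreal (exp (- (b * r))) * indicator {0..} r"
        by eventually_elim (use laplace_symbol_pos[OF assms(2), of \<xi>] in
          \<open>auto simp: indicator_def powr_def b_def algebra_simps exp_add[symmetric]\<close>)
    qed
    also have "\<dots> = ennreal (0 - (- exp (- (b * 0)) / b))"
    proof (rule nn_integral_FTC_atLeast)
      show "((\<lambda>r. - exp (- (b * r)) / b) has_real_derivative exp (- (b * r))) (at r)" for r
        using b by (auto intro!: derivative_eq_intros)
      have "filterlim (\<lambda>r. - (b * r)) at_bot at_top"
        using b by (simp add: filterlim_uminus_at_bot filterlim_tendsto_pos_mult_at_top[OF tendsto_const _ filterlim_ident])
      then have "((\<lambda>r. exp (- (b * r))) \<longlongrightarrow> 0) at_top"
        by (rule filterlim_compose[OF exp_at_bot])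
      then show "((\<lambda>r. - exp (- (b * r)) / b) \<longlongrightarrow> 0) at_top"
        using tendsto_divide[OF tendsto_minus tendsto_const, of "\<lambda>r. exp (- (b * r))" 0 at_top b] b by simp
    qed (use b in auto)
    finally show ?thesis by (simp add: b_def)
  qed
qed (use assms in \<open>auto simp: indicator_def split: if_splits\<close>)

section \<open>Comparison of the two symbols\<close>

text \<open>
  With \<open>D = (\<lambda> + t)\<^sup>\<delta> - (1 + t)\<^sup>\<delta>\<close> the two ratios
  with exponent \<open>\<delta>\<close> are \<open>1 - D (\<lambda> +
  t)\<^bsup>-\<delta>\<^esup>\<close> and \<open>1 + D (1 + t)\<^bsup>-\<delta>\<^esup>\<close>.
  This needs \<open>\<delta> < 1\<close>, so the exponent \<open>s\<close> is split into
  \<open>N\<close> equal parts.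
\<close>
lemma Lp_multiplier_power_ratio:
  assumes p: "1 \<le> p" and lam: "lam > 1" and s: "s > 0"
  shows "Lp_multiplier p (\<lambda>\<xi>::real^'n::finite. laplace_symbol 1 \<xi> powr s * laplace_symbol lam \<xi> powr (- s))"
    and "Lp_multiplier p (\<lambda>\<xi>::real^'n::finite. laplace_symbol lam \<xi> powr s * laplace_symbol 1 \<xi> powr (- s))"
proof -
  \<comment> \<open>Any \<open>N > s\<close> brings the exponent \<open>s / N\<close> below one.\<close>
  obtain N :: nat where N: "s < real N" using reals_Archimedean2 by blast
  define \<delta> where "\<delta> = s / real N"
  have \<delta>: "0 < \<delta>" "\<delta> < 1" "\<delta> * real N = s" using N s by (auto simp: \<delta>_def)
  let ?d = "\<lambda>\<xi>::real^'n. laplace_symbol lam \<xi> powr \<delta> - laplace_symbol 1 \<xi> powr \<delta>"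
  note d = Lp_multiplier_power_difference[OF p lam \<delta>(1,2)]
  have pos: "laplace_symbol 1 \<xi> > 0" "laplace_symbol lam \<xi> > 0" for \<xi> :: "real^'n"
    using lam by (auto intro: laplace_symbol_pos)
  have pw: "(x powr e) ^ N = x powr (e * real N)" if "x > 0" for x e :: real
    using powr_realpow[of "x powr e" N] that by (simp add: powr_powr)
  have root: "(u powr \<delta> * v powr (- \<delta>)) ^ N = u powr s * v powr (- s)" if "u > 0" "v > 0" for u v :: real
    by (simp only: power_mult_distrib pw[OF that(1)] pw[OF that(2)] mult_minus_left \<delta>(3))
  have "Lp_multiplier p (\<lambda>\<xi>::real^'n. (1 + (-1) * (?d \<xi> * laplace_symbol lam \<xi> powr (- \<delta>))) ^ N)"
    using lam \<delta>(1) by (intro Lp_multiplier_power[OF p] Lp_multiplier_add[OF p] Lp_multiplier_mult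
      Lp_multiplier_const[OF p] d Lp_multiplier_bessel[OF p]) auto
  also have "(\<lambda>\<xi>::real^'n. (1 + (-1) * (?d \<xi> * laplace_symbol lam \<xi> powr (- \<delta>))) ^ N) =
      (\<lambda>\<xi>. (laplace_symbol 1 \<xi> powr \<delta> * laplace_symbol lam \<xi> powr (- \<delta>)) ^ N)"
    using pos(2)[THEN less_imp_neq] by (simp add: left_diff_distrib fun_eq_iff flip: powr_add)
  finally show "Lp_multiplier p (\<lambda>\<xi>::real^'n::finite. laplace_symbol 1 \<xi> powr s * laplace_symbol lam \<xi> powr (- s))"
    by (simp only: root pos)
  have "Lp_multiplier p (\<lambda>\<xi>::real^'n. (1 + ?d \<xi> * laplace_symbol 1 \<xi> powr (- \<delta>)) ^ N)"
    using \<delta>(1) by (intro Lp_multiplier_power[OF p] Lp_multiplier_add[OF p] Lp_multiplier_mult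
      Lp_multiplier_const[OF p] d Lp_multiplier_bessel[OF p]) auto
  also have "(\<lambda>\<xi>::real^'n. (1 + ?d \<xi> * laplace_symbol 1 \<xi> powr (- \<delta>)) ^ N) =
      (\<lambda>\<xi>. (laplace_symbol lam \<xi> powr \<delta> * laplace_symbol 1 \<xi> powr (- \<delta>)) ^ N)"
    using pos(1)[THEN less_imp_neq] by (simp add: left_diff_distrib fun_eq_iff flip: powr_add)
  finally show "Lp_multiplier p (\<lambda>\<xi>::real^'n::finite. laplace_symbol lam \<xi> powr s * laplace_symbol 1 \<xi> powr (- s))"
    by (simp only: root pos)
qed

lemma log_symbol_eq: "log_symbol s lam \<xi> = laplace_symbol lam \<xi> powr s * ln (laplace_symbol lam \<xi>)"
  by (simp add: log_symbol_def laplace_symbol_def)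

lemma opic_trebels_symbol_eq: "opic_trebels_symbol s \<xi> = laplace_symbol 1 \<xi> powr s * (1 + ln (laplace_symbol 1 \<xi>))"
  by (simp add: opic_trebels_symbol_def laplace_symbol_def)

text \<open>
  With \<open>L = ln (\<lambda> + t) - ln (1 + t)\<close> the ratios of the logarithmic factors
  are \<open>1 + (1 - L) / ln (\<lambda> + t)\<close> and \<open>1 + (L - 1) / (1 + ln (1 +
  t))\<close>.
\<close>
lemma Lp_multiplier_symbol_ratio:
  assumes p: "1 \<le> p" and lam: "lam > 1" and s: "s > 0"
  shows "\<exists>m. Lp_multiplier p m \<and> (\<forall>\<xi>::real^'n::finite. opic_trebels_symbol s \<xi> = m \<xi> * log_symbol s lam \<xi>)"
    and "\<exists>m. Lp_multiplier p m \<and> (\<forall>\<xi>::real^'n::finite. log_symbol s lam \<xi> = m \<xi> * opic_trebels_symbol s \<xi>)"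
proof -
  note ln_diff = Lp_multiplier_ln_difference[OF p lam]
  have pos: "laplace_symbol 1 \<xi> > 0" "laplace_symbol lam \<xi> > 0" "ln (laplace_symbol lam \<xi>) > 0" "1 + ln (laplace_symbol 1 \<xi>) > 0" for \<xi> :: "real^'n"
    using lam ln_laplace_symbol_pos[of lam 0 \<xi>] ln_laplace_symbol_pos[of 1 1 \<xi>] by (auto intro: laplace_symbol_pos)
  let ?L = "\<lambda>\<xi>::real^'n. ln (laplace_symbol lam \<xi>) - ln (laplace_symbol 1 \<xi>)"
  let ?m = "\<lambda>\<xi>::real^'n. (laplace_symbol 1 \<xi> powr s * laplace_symbol lam \<xi> powr (- s)) * (1 + (1 + (-1) * ?L \<xi>) * (1 / (0 + ln (laplace_symbol lam \<xi>))))"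
  let ?n = "\<lambda>\<xi>::real^'n. (laplace_symbol lam \<xi> powr s * laplace_symbol 1 \<xi> powr (- s)) * (1 + (?L \<xi> + (-1)) * (1 / (1 + ln (laplace_symbol 1 \<xi>))))"
  have "Lp_multiplier p ?m"
    using lam by (intro Lp_multiplier_mult Lp_multiplier_power_ratio(1)[OF p lam s] Lp_multiplier_add[OF p]
      Lp_multiplier_const[OF p] ln_diff Lp_multiplier_inverse_ln[OF p]) auto
  moreover have "opic_trebels_symbol s \<xi> = ?m \<xi> * log_symbol s lam \<xi>" for \<xi> :: "real^'n"
    using pos[of \<xi>] by (simp add: log_symbol_eq opic_trebels_symbol_eq powr_minus field_simps)
  ultimately show "\<exists>m. Lp_multiplier p m \<and> (\<forall>\<xi>::real^'n::finite. opic_trebels_symbol s \<xi> = m \<xi> * log_symbol s lam \<xi>)"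
    by blast
  have "Lp_multiplier p ?n"
    by (intro Lp_multiplier_mult Lp_multiplier_power_ratio(2)[OF p lam s] Lp_multiplier_add[OF p]
      Lp_multiplier_const[OF p] ln_diff Lp_multiplier_inverse_ln[OF p]) auto
  moreover have "log_symbol s lam \<xi> = ?n \<xi> * opic_trebels_symbol s \<xi>" for \<xi> :: "real^'n"
  proof -
    have "(1 + (?L \<xi> + (-1)) * (1 / (1 + ln (laplace_symbol 1 \<xi>)))) * (1 + ln (laplace_symbol 1 \<xi>)) = ln (laplace_symbol lam \<xi>)"
      using pos(4)[of \<xi>] by (simp add: field_simps)
    moreover have "laplace_symbol 1 \<xi> powr (- s) * laplace_symbol 1 \<xi> powr s = 1"
      using pos(1)[of \<xi>] by (simp add: powr_minus)
    moreover have "?n \<xi> * opic_trebels_symbol s \<xi> = laplace_symbol lam \<xi> powr s * (laplace_symbol 1 \<xi> powr (- s) * laplace_symbol 1 \<xi> powr s) *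
        ((1 + (?L \<xi> + (-1)) * (1 / (1 + ln (laplace_symbol 1 \<xi>)))) * (1 + ln (laplace_symbol 1 \<xi>)))"
      by (simp only: opic_trebels_symbol_eq mult_ac)
    ultimately show ?thesis
      by (simp only: log_symbol_eq mult_1_right)
  qed
  ultimately show "\<exists>m. Lp_multiplier p m \<and> (\<forall>\<xi>::real^'n::finite. log_symbol s lam \<xi> = m \<xi> * opic_trebels_symbol s \<xi>)"
    by blast
qed

lemma fourier_multiplier_apply:
  assumes "(\<lambda>\<xi>. complex_of_real (a \<xi>)) \<in> symbols" "\<phi> \<in> schwartz"
  shows "fourier_multiplier a u \<phi> = u (fourier (\<lambda>\<xi>. of_real (a \<xi>) * inverse_fourier \<phi> \<xi>))"
  using assms by (simp add: fourier_multiplier_def inverse_fourier_dist_def mult_dist_def fourier_dist_def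
    schwartz_inverse_fourier schwartz_symbol_mult)

text \<open>
  By inversion, \<open>b F\<^bsup>-1\<^esup>\<phi> = a F\<^bsup>-1\<^esup>\<psi>\<close> for
  \<open>\<psi> = F(m F\<^bsup>-1\<^esup>\<phi>)\<close>, so the functional with symbol
  \<open>b\<close> at \<open>\<phi>\<close> is the functional with symbol \<open>a\<close> at
  \<open>\<psi>\<close>; if the latter is represented by \<open>f\<close>, the former is
  represented by the function that \<open>m\<close> assigns to \<open>f\<close>.
\<close>
lemma fourier_multiplier_transfer:
  fixes a b m :: "real^'n::finite \<Rightarrow> real"
  assumes p: "1 \<le> p" and m: "Lp_multiplier p m"
    and a: "(\<lambda>\<xi>. complex_of_real (a \<xi>)) \<in> symbols" and b: "(\<lambda>\<xi>. complex_of_real (b \<xi>)) \<in> symbols"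
    and eq: "\<And>\<xi>. b \<xi> = m \<xi> * a \<xi>"
  shows "\<exists>C\<ge>1. \<forall>u. \<forall>f\<in>Lp p. fourier_multiplier a u = dist_of_fun f \<longrightarrow>
    (\<exists>g\<in>Lp p. fourier_multiplier b u = dist_of_fun g \<and> Lp_norm p g \<le> ennreal C * Lp_norm p f)"
proof -
  note sm = Lp_multiplier_symbol[OF m]
  obtain C where C: "C \<ge> 0" "\<And>f K. f \<in> borel_measurable borel \<Longrightarrow> K \<ge> 0 \<Longrightarrow> Lp_bound p f K \<Longrightarrow>
    \<exists>g\<in>borel_measurable borel. Lp_bound p g (C * K) \<and> weak_multiplier m f g"
    using Lp_multiplierE[OF m] by blast
  have "\<exists>g\<in>Lp p. fourier_multiplier b u = dist_of_fun g \<and> Lp_norm p g \<le> ennreal (C + 1) * Lp_norm p f"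
    if f: "f \<in> Lp p" and u: "fourier_multiplier a u = dist_of_fun f" for f u
  proof -
    have fm: "f \<in> borel_measurable borel" using f by (simp add: Lp_def)
    obtain K where K: "K \<ge> 0" "Lp_norm p f = ennreal K"
      using f by (cases "Lp_norm p f") (auto simp: Lp_def)
    then have "Lp_bound p f K" using Lp_norm_le_iff_Lp_bound[OF _ p K(1), of f] fm by simp
    then obtain g where g: "g \<in> borel_measurable borel" "Lp_bound p g (C * K)" "weak_multiplier m f g"
      using C(2)[OF fm K(1)] by blast
    have le: "Lp_norm p g \<le> ennreal (C * K)"
      using Lp_norm_le_iff_Lp_bound[OF _ p, of g "C * K"] g C(1) K(1) by simp
    have "fourier_multiplier b u \<phi> = dist_of_fun g \<phi>" for \<phi>
    proof (cases "\<phi> \<in> schwartz")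
      case False
      then show ?thesis by (simp add: fourier_multiplier_def inverse_fourier_dist_def dist_of_fun_def)
    next
      case True
      let ?\<psi> = "fourier (\<lambda>\<xi>. of_real (m \<xi>) * inverse_fourier \<phi> \<xi>)"
      have \<psi>: "?\<psi> \<in> schwartz" by (rule schwartz_multiplier[OF sm True])
      have "inverse_fourier ?\<psi> = (\<lambda>\<xi>. of_real (m \<xi>) * inverse_fourier \<phi> \<xi>)"
        by (intro inverse_fourier_fourier_schwartz schwartz_symbol_mult schwartz_inverse_fourier sm True)
      then have "(\<lambda>\<xi>. of_real (b \<xi>) * inverse_fourier \<phi> \<xi>) = (\<lambda>\<xi>. of_real (a \<xi>) * inverse_fourier ?\<psi> \<xi>)"
        by (simp only: eq of_real_mult mult.assoc mult.left_commute)
      then have "fourier_multiplier b u \<phi> = fourier_multiplier a u ?\<psi>"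
        by (simp only: fourier_multiplier_apply[OF b True] fourier_multiplier_apply[OF a \<psi>])
      also have "\<dots> = dist_of_fun g \<phi>"
        by (simp add: u dist_of_fun_def True \<psi> weak_multiplierD[OF g(3) True])
      finally show ?thesis .
    qed
    then have "fourier_multiplier b u = dist_of_fun g" by blast
    moreover have "g \<in> Lp p"
      using g(1) le by (auto simp: Lp_def intro: order_le_less_trans)
    moreover have "ennreal (C * K) \<le> ennreal (C + 1) * Lp_norm p f"
      using C(1) K by (simp add: algebra_simps flip: ennreal_mult)
    ultimately show ?thesis using le order_trans by blast
  qed
  \<comment> \<open>The constant is enlarged from \<open>C\<close> to \<open>C + 1\<close> so that it is at least one.\<close>
  with C(1) show ?thesis by (intro exI[of _ "C + 1"]) auto
qed

text \<open>
  If \<open>v\<close> has no representative in \<open>L\<^sup>p\<close>, its norm is the infimum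
  of the empty set, which is \<open>\<infinity>\<close>, and both estimates hold.
\<close>
lemma Lp_norm_dist_transfer:
  assumes C: "C \<ge> 1" and transfer: "\<And>f. f \<in> Lp p \<Longrightarrow> v = dist_of_fun f \<Longrightarrow>
    \<exists>g\<in>Lp p. w = dist_of_fun g \<and> Lp_norm p g \<le> ennreal C * Lp_norm p f"
  shows "ennreal (1 / C) * Lp_norm_dist p w \<le> Lp_norm_dist p v"
    and "Lp_norm_dist p w \<le> ennreal C * Lp_norm_dist p v"
proof -
  have inv: "ennreal (1 / C) * (ennreal C * x) = x" "ennreal C * (ennreal (1 / C) * x) = x" for x
    using C by (simp_all add: mult.assoc[symmetric] ennreal_mult[symmetric])
  show *: "ennreal (1 / C) * Lp_norm_dist p w \<le> Lp_norm_dist p v"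
    unfolding Lp_norm_dist_def[of p v]
  proof (rule INF_greatest)
    fix f assume "f \<in> {f \<in> Lp p. v = dist_of_fun f}"
    then obtain g where g: "g \<in> Lp p" "w = dist_of_fun g" "Lp_norm p g \<le> ennreal C * Lp_norm p f"
      using transfer by blast
    have "Lp_norm_dist p w \<le> Lp_norm p g"
      unfolding Lp_norm_dist_def by (rule INF_lower) (use g in auto)
    also note g(3)
    finally have "ennreal (1 / C) * Lp_norm_dist p w \<le> ennreal (1 / C) * (ennreal C * Lp_norm p f)"
      by (rule mult_left_mono) simp
    then show "ennreal (1 / C) * Lp_norm_dist p w \<le> Lp_norm p f" by (simp only: inv)
  qed
  have "ennreal C * (ennreal (1 / C) * Lp_norm_dist p w) \<le> ennreal C * Lp_norm_dist p v"
    using * by (rule mult_left_mono) simp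
  then show "Lp_norm_dist p w \<le> ennreal C * Lp_norm_dist p v" by (simp only: inv)
qed

theorem proposition1p13:
  fixes s lam :: real and p :: ennreal
  assumes "s > 0" and "lam > 1" and "1 \<le> p"
  shows "(log_space p s lam :: ((real^'n::finite \<Rightarrow> complex) \<Rightarrow> complex) set) = opic_trebels_space p s \<and>
    (\<exists>C::real. C \<ge> 1 \<and>
      (\<forall>u \<in> (log_space p s lam :: ((real^'n \<Rightarrow> complex) \<Rightarrow> complex) set).
         ennreal (1 / C) * opic_trebels_norm p s u \<le> log_space_norm p s lam u \<and>
         log_space_norm p s lam u \<le> ennreal C * opic_trebels_norm p s u) \<and>
      (\<forall>\<phi> \<in> (schwartz :: (real^'n \<Rightarrow> complex) set).
         ennreal (1 / C) * opic_trebels_norm p s (dist_of_fun \<phi>) \<le> log_space_norm p s lam (dist_of_fun \<phi>) \<and>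
         log_space_norm p s lam (dist_of_fun \<phi>) \<le> ennreal C * opic_trebels_norm p s (dist_of_fun \<phi>)))"
proof -
  let ?a = "log_symbol s lam :: real^'n \<Rightarrow> real" and ?b = "opic_trebels_symbol s :: real^'n \<Rightarrow> real"
  have a: "(\<lambda>\<xi>. complex_of_real (?a \<xi>)) \<in> symbols"
    using symbols.mult[OF symbols.powr symbols.ln, of lam lam s] assms by (simp add: log_symbol_eq)
  have b: "(\<lambda>\<xi>. complex_of_real (?b \<xi>)) \<in> symbols"
    using symbols.mult[OF symbols.powr symbols.add[OF symbols.const symbols.ln], of 1 1 s 1]
    by (simp add: opic_trebels_symbol_eq)
  obtain m where m: "Lp_multiplier p m" "\<And>\<xi>. ?b \<xi> = m \<xi> * ?a \<xi>"
    using Lp_multiplier_symbol_ratio(1)[OF assms(3,2,1)] by blast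
  obtain n where n: "Lp_multiplier p n" "\<And>\<xi>. ?a \<xi> = n \<xi> * ?b \<xi>"
    using Lp_multiplier_symbol_ratio(2)[OF assms(3,2,1)] by blast
  obtain C where C: "C \<ge> 1" "\<And>u f. f \<in> Lp p \<Longrightarrow> fourier_multiplier ?a u = dist_of_fun f \<Longrightarrow>
      \<exists>g\<in>Lp p. fourier_multiplier ?b u = dist_of_fun g \<and> Lp_norm p g \<le> ennreal C * Lp_norm p f"
    using fourier_multiplier_transfer[OF assms(3) m(1) a b m(2)] by blast
  obtain D where D: "D \<ge> 1" "\<And>u f. f \<in> Lp p \<Longrightarrow> fourier_multiplier ?b u = dist_of_fun f \<Longrightarrow>
      \<exists>g\<in>Lp p. fourier_multiplier ?a u = dist_of_fun g \<and> Lp_norm p g \<le> ennreal D * Lp_norm p f"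
    using fourier_multiplier_transfer[OF assms(3) n(1) b a n(2)] by blast
  define E where "E = max C D"
  have E: "E \<ge> 1" "C \<le> E" "D \<le> E" using C(1) by (auto simp: E_def)
  have up: "ennreal C * x \<le> ennreal E * x" "ennreal D * x \<le> ennreal E * x" for x
    using E by (auto intro!: mult_right_mono ennreal_leI)
  have "ennreal (1 / E) * opic_trebels_norm p s u \<le> log_space_norm p s lam u" for u :: "(real^'n \<Rightarrow> complex) \<Rightarrow> complex"
    unfolding opic_trebels_norm_def log_space_norm_def log_bessel_op_def
    by (rule Lp_norm_dist_transfer(1)[OF E(1)]) (use C(2) up order_trans in blast)
  moreover have "log_space_norm p s lam u \<le> ennreal E * opic_trebels_norm p s u" for u :: "(real^'n \<Rightarrow> complex) \<Rightarrow> complex"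
    unfolding opic_trebels_norm_def log_space_norm_def log_bessel_op_def
    by (rule Lp_norm_dist_transfer(2)[OF E(1)]) (use D(2) up order_trans in blast)
  moreover have "(log_space p s lam :: ((real^'n \<Rightarrow> complex) \<Rightarrow> complex) set) = opic_trebels_space p s"
    unfolding log_space_def opic_trebels_space_def in_Lp_def log_bessel_op_def using C(2) D(2) by blast
  ultimately show ?thesis using E(1) by blast
qed

end
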